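(* Let $D$ be a VFD that is not a field. The following statements are equivalent. (1) $D$ is a weakly factorial GCD-domain. (2) $t$-$\dim(D)=1$. (3) $D$ is completely integrally closed. (4) $D$ is archimedean. (5) $D$ satisfies the Principal Ideal Theorem.
   Context: Let $D$ be an integral domain with quotient field $K$. An overring of $D$ is a subring of $K$ containing $D$. A nonzero nonunit $a\in D$ is a valuation element of $D$ if there is a valuation domain $V$ that is an overring of $D$ with $aV\cap D=aD$. $D$ is a VFD (valuation factorization domain) if every nonzero nonunit of $D$ is a finite product of valuation elements. A nonzero nonunit $x\in D$ is primary if $xD$ is a primary ideal. $D$ is a weakly factorial domain if every nonzero nonunit is a finite product of primary elements; a weakly factorial GCD-domain is a GCD-domain that is weakly factorial. For a nonzero fractional ideal $A$ let $A^{-1}=\{x\in K\mid xA\subseteq D\}$, $A_v=(A^{-1})^{-1}$ and $A_t=\bigcup\{I_v\mid I\subseteq A,\ I$ a nonzero finitely generated fractional ideal$\}$. $A$ is a $t$-ideal if $A_t=A$; a prime $t$-ideal is a (nonzero) prime ideal that is a $t$-ideal. $t$-$\dim(D)=\sup\{n\mid P_1\subsetneq\cdots\subsetneq P_n$ for some prime $t$-ideals $P_i$ of $D\}$. An element $x\in K$ is almost integral over $D$ if there is a nonzero $c\in D$ with $cx^n\in D$ for all positive integers $n$; $D$ is completely integrally closed if every element of $K$ almost integral over $D$ lies in $D$. $D$ is archimedean if $\bigcap_{n\ge 1}x^nD=(0)$ for each nonunit $x\in D$. $D$ satisfies the Principal Ideal Theorem if each minimal prime ideal of each nonzero principal ideal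 of $D$ has height one. *)

theory Defs
  imports "HOL-Algebra.Algebraic_Closure_Type" "HOL-Library.Extended_Nat"
begin

text \<open>
  The quotient field is a type \<open>'k :: field\<close>; the domain \<open>D\<close>, its ideals, its overrings and its
  fractional ideals are all subsets of \<open>'k\<close>.  The structure \<open>ring_of_type_algebra\<close> presents
  \<open>'k\<close> to the locale-based algebra library, and \<open>ring_on D\<close> is the ring \<open>D\<close> with the
  operations inherited from \<open>'k\<close>.
\<close>

definition ring_on :: "'k::field set \<Rightarrow> 'k ring" where
  "ring_on D = ring_of_type_algebra\<lparr>carrier := D\<rparr>"

definition domain_with_quotient_field :: "'k::field set \<Rightarrow> bool" where
  "domain_with_quotient_field D \<longleftrightarrow>
     subring D ring_of_type_algebra \<and> (\<forall>x. \<exists>a\<in>D. \<exists>b\<in>D. b \<noteq> 0 \<and> x = a / b)"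

definition overring :: "'k::field set \<Rightarrow> 'k set \<Rightarrow> bool" where
  "overring D V \<longleftrightarrow> subring V ring_of_type_algebra \<and> D \<subseteq> V"

definition nonzero_nonunits :: "'k::field set \<Rightarrow> 'k set" where
  "nonzero_nonunits D = {x \<in> D. x \<noteq> 0 \<and> x \<notin> Units (ring_on D)}"

definition scaled_set :: "'k::field \<Rightarrow> 'k set \<Rightarrow> 'k set" where
  "scaled_set x A = {x * a | a. a \<in> A}"


subsection \<open>Valuation elements and VFDs\<close>

text \<open>A valuation domain whose quotient field is all of \<open>'k\<close>; the last conjunct already implies
  that every element of \<open>'k\<close> is a quotient of elements of \<open>V\<close>.\<close>

definition valuation_domain :: "'k::field set \<Rightarrow> bool" where
  "valuation_domain V \<longleftrightarrow>
     subring V ring_of_type_algebra \<and> (\<forall>x. x \<noteq> 0 \<longrightarrow> x \<in> V \<or> inverse x \<in> V)"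

definition valuation_element :: "'k::field set \<Rightarrow> 'k \<Rightarrow> bool" where
  "valuation_element D a \<longleftrightarrow> a \<in> nonzero_nonunits D \<and>
     (\<exists>V. overring D V \<and> valuation_domain V \<and> scaled_set a V \<inter> D = scaled_set a D)"

definition VFD :: "'k::field set \<Rightarrow> bool" where
  "VFD D \<longleftrightarrow> domain_with_quotient_field D \<and>
     (\<forall>x \<in> nonzero_nonunits D. \<exists>as. (\<forall>a \<in> set as. valuation_element D a) \<and> x = prod_list as)"


subsection \<open>Weakly factorial GCD-domains\<close>

definition primary_ideal :: "'k::field set \<Rightarrow> 'k set \<Rightarrow> bool" where
  "primary_ideal D Q \<longleftrightarrow> ideal Q (ring_on D) \<and> Q \<noteq> D \<and>
     (\<forall>a\<in>D. \<forall>b\<in>D. a * b \<in> Q \<longrightarrow> a \<in> Q \<or> (\<exists>n\<ge>1. b ^ n \<in> Q))"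

definition primary_element :: "'k::field set \<Rightarrow> 'k \<Rightarrow> bool" where
  "primary_element D x \<longleftrightarrow> x \<in> nonzero_nonunits D \<and> primary_ideal D (scaled_set x D)"

definition weakly_factorial :: "'k::field set \<Rightarrow> bool" where
  "weakly_factorial D \<longleftrightarrow> domain_with_quotient_field D \<and>
     (\<forall>x \<in> nonzero_nonunits D. \<exists>ps. (\<forall>p \<in> set ps. primary_element D p) \<and> x = prod_list ps)"

text \<open>The library phrases existence of greatest common divisors for cancellative monoids, so it is
  applied to the multiplicative monoid of nonzero elements.\<close>

definition GCD_domain :: "'k::field set \<Rightarrow> bool" where
  "GCD_domain D \<longleftrightarrow> domain_with_quotient_field D \<and> gcd_condition_monoid (mult_of (ring_on D))"


subsection \<open>The t-operation and the t-dimension\<close>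

definition nonzero_fractional_ideal :: "'k::field set \<Rightarrow> 'k set \<Rightarrow> bool" where
  "nonzero_fractional_ideal D A \<longleftrightarrow>
     additive_subgroup A ring_of_type_algebra \<and> (\<forall>d\<in>D. \<forall>x\<in>A. d * x \<in> A) \<and>
     A \<noteq> {0} \<and> (\<exists>d\<in>D. d \<noteq> 0 \<and> scaled_set d A \<subseteq> D)"

definition nonzero_fg_fractional_ideal :: "'k::field set \<Rightarrow> 'k set \<Rightarrow> bool" where
  "nonzero_fg_fractional_ideal D A \<longleftrightarrow> nonzero_fractional_ideal D A \<and>
     (\<exists>S. finite S \<and> A = {\<Sum>s\<in>S. c s * s | c. \<forall>s\<in>S. c s \<in> D})"

definition inverse_ideal :: "'k::field set \<Rightarrow> 'k set \<Rightarrow> 'k set" where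
  "inverse_ideal D A = {x. scaled_set x A \<subseteq> D}"

definition v_closure :: "'k::field set \<Rightarrow> 'k set \<Rightarrow> 'k set" where
  "v_closure D A = inverse_ideal D (inverse_ideal D A)"

definition t_closure :: "'k::field set \<Rightarrow> 'k set \<Rightarrow> 'k set" where
  "t_closure D A = \<Union> {v_closure D I | I. I \<subseteq> A \<and> nonzero_fg_fractional_ideal D I}"

definition prime_t_ideal :: "'k::field set \<Rightarrow> 'k set \<Rightarrow> bool" where
  "prime_t_ideal D P \<longleftrightarrow> primeideal P (ring_on D) \<and> P \<noteq> {0} \<and> t_closure D P = P"

text \<open>Chains are lists \<open>[P\<^sub>1, \<dots>, P\<^sub>n]\<close>.  The empty list is admitted and only contributes \<open>0\<close>.\<close>

definition t_dim :: "'k::field set \<Rightarrow> enat" where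
  "t_dim D = Sup {enat (length Ps) | Ps. (\<forall>P \<in> set Ps. prime_t_ideal D P) \<and> sorted_wrt (\<subset>) Ps}"


subsection \<open>Complete integral closure, the archimedean property, the Principal Ideal Theorem\<close>

definition almost_integral :: "'k::field set \<Rightarrow> 'k \<Rightarrow> bool" where
  "almost_integral D x \<longleftrightarrow> (\<exists>c\<in>D. c \<noteq> 0 \<and> (\<forall>n\<ge>1. c * x ^ n \<in> D))"

definition completely_integrally_closed :: "'k::field set \<Rightarrow> bool" where
  "completely_integrally_closed D \<longleftrightarrow> (\<forall>x. almost_integral D x \<longrightarrow> x \<in> D)"

definition archimedean :: "'k::field set \<Rightarrow> bool" where
  "archimedean D \<longleftrightarrow> (\<forall>x\<in>D. x \<notin> Units (ring_on D) \<longrightarrow> (\<Inter>n\<in>{1::nat..}. scaled_set (x ^ n) D) = {0})"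

text \<open>The height of \<open>P\<close> is the supremum of the \<open>n\<close> for which there are prime ideals
  \<open>P\<^sub>0 \<subset> \<dots> \<subset> P\<^sub>n = P\<close>; the list \<open>Ps\<close> below is \<open>[P\<^sub>0, \<dots>, P\<^sub>n\<^sub>-\<^sub>1]\<close>.\<close>

definition height :: "'k::field set \<Rightarrow> 'k set \<Rightarrow> enat" where
  "height D P = Sup {enat (length Ps) | Ps.
     (\<forall>Q \<in> set Ps. primeideal Q (ring_on D)) \<and> sorted_wrt (\<subset>) (Ps @ [P])}"

definition minimal_prime_over :: "'k::field set \<Rightarrow> 'k set \<Rightarrow> 'k set \<Rightarrow> bool" where
  "minimal_prime_over D A P \<longleftrightarrow> primeideal P (ring_on D) \<and> A \<subseteq> P \<and>
     (\<forall>Q. primeideal Q (ring_on D) \<and> A \<subseteq> Q \<and> Q \<subseteq> P \<longrightarrow> Q = P)"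

definition principal_ideal_theorem :: "'k::field set \<Rightarrow> bool" where
  "principal_ideal_theorem D \<longleftrightarrow>
     (\<forall>a\<in>D. a \<noteq> 0 \<longrightarrow> (\<forall>P. minimal_prime_over D (scaled_set a D) P \<longrightarrow> height D P = 1))"

end

theory Submission
  imports Defs
begin

text \<open>
  Let \<open>a\<close> be a valuation element with valuation overring \<open>V\<close>.  Divisors and powers of \<open>a\<close>
  inherit \<open>V\<close>, so that comparability in \<open>V\<close> descends to \<open>D\<close>: any two divisors of a power of \<open>a\<close>
  are comparable (\<open>power_divisors_comparable\<close>), and both the radical of \<open>aD\<close> and the intersection
  of the ideals \<open>a\<^sup>nD\<close> are prime.  In a VFD it follows that any finitely many elements of
  \<open>radical a\<close> have a common divisor in \<open>radical a\<close>; hence \<open>radical a\<close> is a prime t-ideal.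

  The archimedean property is the hub of the equivalence.  If it fails, some valuation element \<open>a\<close>
  has a nonzero intersection \<open>Q\<close> of the ideals \<open>a\<^sup>nD\<close>.  A valuation factor \<open>b\<close> in the prime \<open>Q\<close>
  then gives \<open>radical b \<subset> radical a\<close> (\<open>smaller_radical_if_not_archimedean\<close>).  This is a chain of two
  prime t-ideals, and \<open>radical a\<close> is minimal over \<open>aD\<close>; so both the t-dimension condition and the
  Principal Ideal Theorem fail.

  If \<open>D\<close> is archimedean, then \<open>a\<close> divides a power of each of its nonunit divisors.  So the tree of
  the primes \<open>radical a\<close> is flat: these primes have height one, \<open>a\<close> is primary, and two valuation
  elements are either comparable or coprime in the strong sense of \<open>v_coprime\<close>.  Splitting off common
  factors one valuation element at a time writes every fraction in lowest terms
  (\<open>coprime_split\<close>), which yields greatest common divisors and complete integral closedness.  A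
  prime t-ideal contains no two coprime elements, so it is one of the \<open>radical a\<close>.

  Weakly factorial domains and completely integrally closed domains are archimedean without any
  valuation theory.  For the former the point is that for primary \<open>x\<close> and \<open>y\<close> an inclusion of the
  radicals is an equality (\<open>primary_radical_sym\<close>).
\<close>

section \<open>Divisibility in a subring of a field\<close>

locale subring_of_field =
  fixes D :: "'k::field set"
  assumes subring: "subring D ring_of_type_algebra"
begin

lemma zero_mem [simp]: "0 \<in> D" and one_mem [simp]: "1 \<in> D"
  using subringE(2,3)[OF subring] by (simp_all add: ring_of_type_algebra_def)

lemma add_mem: "x \<in> D \<Longrightarrow> y \<in> D \<Longrightarrow> x + y \<in> D"
  and mult_mem: "x \<in> D \<Longrightarrow> y \<in> D \<Longrightarrow> x * y \<in> D"
  using subringE(6,7)[OF subring] by (simp_all add: ring_of_type_algebra_def)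

lemma neg_mem:
  assumes "x \<in> D" shows "- x \<in> D"
proof -
  interpret K: ring "ring_of_type_algebra :: 'k ring" by (rule ring_from_type_algebra)
  have "\<ominus>\<^bsub>ring_of_type_algebra\<^esub> x = - x"
    by (rule K.minus_equality) (simp_all add: ring_of_type_algebra_def)
  then show ?thesis using subringE(5)[OF subring assms] by simp
qed

lemma power_mem: "x \<in> D \<Longrightarrow> x ^ n \<in> D"
  by (induction n) (auto intro: mult_mem)

lemma sum_mem: "(\<And>s. s \<in> S \<Longrightarrow> f s \<in> D) \<Longrightarrow> sum f S \<in> D"
  by (induction S rule: infinite_finite_induct) (auto intro: add_mem)

lemma prod_list_mem: "set xs \<subseteq> D \<Longrightarrow> prod_list xs \<in> D"
  by (induction xs) (auto intro: mult_mem)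

definition divides_in :: "'k \<Rightarrow> 'k \<Rightarrow> bool" (infix \<open>dvd\<^sub>D\<close> 50)
  where "a dvd\<^sub>D b \<longleftrightarrow> (\<exists>c\<in>D. b = a * c)"

lemma scaled_set_eq: "scaled_set a D = {x. a dvd\<^sub>D x}"
  by (auto simp: scaled_set_def divides_in_def)

lemma dvdI: "c \<in> D \<Longrightarrow> a dvd\<^sub>D a * c" and dvdI': "c \<in> D \<Longrightarrow> a dvd\<^sub>D c * a"
  by (auto simp: divides_in_def mult.commute)

lemma dvdE: 
  assumes "a dvd\<^sub>D b" obtains c where "c \<in> D" "b = a * c"
  using assms by (auto simp: divides_in_def)

lemma dvd_refl [simp]: "a dvd\<^sub>D a"
  using dvdI[of 1 a] by simp

lemma dvd_zero [simp]: "a dvd\<^sub>D 0"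
  using dvdI[of 0 a] by simp

lemma one_dvd_iff [simp]: "1 dvd\<^sub>D a \<longleftrightarrow> a \<in> D"
  by (auto simp: divides_in_def)

lemma dvd_trans: "a dvd\<^sub>D b \<Longrightarrow> b dvd\<^sub>D c \<Longrightarrow> a dvd\<^sub>D c"
  unfolding divides_in_def using mult_mem by (metis mult.assoc)

lemma dvd_add: "a dvd\<^sub>D b \<Longrightarrow> a dvd\<^sub>D c \<Longrightarrow> a dvd\<^sub>D b + c"
  unfolding divides_in_def using add_mem by (metis distrib_left)

lemma dvd_mult: "a dvd\<^sub>D b \<Longrightarrow> c \<in> D \<Longrightarrow> a dvd\<^sub>D b * c"
  using dvd_trans dvdI by blast

lemma dvd_mult2: "a dvd\<^sub>D b \<Longrightarrow> c \<in> D \<Longrightarrow> a dvd\<^sub>D c * b"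
  using dvd_mult by (simp add: mult.commute)

lemma dvd_mult_mono:
  assumes "a dvd\<^sub>D b" "c dvd\<^sub>D d" shows "a * c dvd\<^sub>D b * d"
proof -
  from assms obtain e f where "e \<in> D" "b = a * e" "f \<in> D" "d = c * f"
    by (auto simp: divides_in_def)
  then show ?thesis
    using dvdI[of "e * f" "a * c"] mult_mem by (simp add: ac_simps)
qed

lemma dvd_power_mono: "a dvd\<^sub>D b \<Longrightarrow> a ^ n dvd\<^sub>D b ^ n"
  by (induction n) (auto intro: dvd_mult_mono)

lemma power_dvd_power: "a \<in> D \<Longrightarrow> m \<le> n \<Longrightarrow> a ^ m dvd\<^sub>D a ^ n"
  by (metis dvdI le_add_diff_inverse power_add power_mem)

lemma dvd_mult_cancel: "c \<noteq> 0 \<Longrightarrow> c * a dvd\<^sub>D c * b \<longleftrightarrow> a dvd\<^sub>D b"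
  by (auto simp: divides_in_def mult.assoc)

lemma dvd_mem: "a dvd\<^sub>D b \<Longrightarrow> a \<in> D \<Longrightarrow> b \<in> D"
  by (auto simp: divides_in_def mult_mem)

lemma dvd_prod_list: "x \<in> set xs \<Longrightarrow> set xs \<subseteq> D \<Longrightarrow> x dvd\<^sub>D prod_list xs"
  by (induction xs) (auto intro: dvdI dvd_mult2 prod_list_mem)

lemma Units_iff: "u \<in> Units (ring_on D) \<longleftrightarrow> u \<in> D \<and> u dvd\<^sub>D 1"
  by (auto simp: Units_def ring_on_def ring_of_type_algebra_def divides_in_def mult.commute)

lemma nonzero_nonunits_iff: "x \<in> nonzero_nonunits D \<longleftrightarrow> x \<in> D \<and> x \<noteq> 0 \<and> \<not> x dvd\<^sub>D 1"
  by (auto simp: nonzero_nonunits_def Units_iff)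


section \<open>Ideals, primary elements and greatest common divisors\<close>

lemma cring_ring_on: "cring (ring_on D)"
proof -
  interpret K: cring "ring_of_type_algebra :: 'k ring" by (rule cring_from_type_algebra)
  show ?thesis
    using K.subcringI'[OF subring] K.subcring_iff[OF subringE(1)[OF subring]]
    by (simp add: ring_on_def)
qed

lemma domain_ring_on: "domain (ring_on D)"
  by (rule domain.intro[OF cring_ring_on], unfold_locales)
    (auto simp: ring_on_def ring_of_type_algebra_def)

lemma ring_on_simps [simp]:
  "carrier (ring_on D) = D" "monoid.mult (ring_on D) = (*)" "ring.add (ring_on D) = (+)"
  "monoid.one (ring_on D) = 1" "ring.zero (ring_on D) = 0"
  by (simp_all add: ring_on_def ring_of_type_algebra_def)

lemma exists_nonzero_nonunit:
  assumes "\<not> field (ring_on D)"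
  shows "\<exists>x. x \<in> nonzero_nonunits D"
proof (rule ccontr)
  assume *: "\<nexists>x. x \<in> nonzero_nonunits D"
  interpret R: cring "ring_on D" by (rule cring_ring_on)
  have "field (ring_on D)"
  proof (rule R.cring_fieldI)
    show "Units (ring_on D) = carrier (ring_on D) - {\<zero>\<^bsub>ring_on D\<^esub>}"
      using * by (auto simp: nonzero_nonunits_def Units_iff divides_in_def)
  qed
  with assms show False by contradiction
qed

lemma ideal_iff:
  "ideal I (ring_on D) \<longleftrightarrow>
     I \<subseteq> D \<and> 0 \<in> I \<and> (\<forall>x\<in>I. \<forall>y\<in>I. x + y \<in> I) \<and> (\<forall>x\<in>I. \<forall>c\<in>D. c * x \<in> I)" (is "_ \<longleftrightarrow> ?R")
proof
  assume "ideal I (ring_on D)"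
  then interpret I: ideal I "ring_on D" .
  show ?R
    using I.a_subset additive_subgroup.zero_closed[OF I.additive_subgroup_axioms]
      additive_subgroup.a_closed[OF I.additive_subgroup_axioms] I.I_l_closed by simp
next
  assume R: ?R
  interpret C: cring "ring_on D" by (rule cring_ring_on)
  show "ideal I (ring_on D)"
  proof (rule idealI)
    show "ring (ring_on D)" by (rule C.ring_axioms)
    show "subgroup I (add_monoid (ring_on D))"
    proof (rule C.add.subgroupI)
      fix a assume a: "a \<in> I"
      then have "a \<in> D" using R by blast
      then have "\<ominus>\<^bsub>ring_on D\<^esub> a = (- 1) * a"
        by (intro C.minus_equality) (auto simp: neg_mem)
      moreover have "(- 1) * a \<in> I" using R a neg_mem one_mem by blast
      ultimately show "\<ominus>\<^bsub>ring_on D\<^esub> a \<in> I"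
        by simp
    qed (use R in auto)
  qed (use R in \<open>simp_all add: mult.commute\<close>)
qed

lemma primeideal_iff:
  "primeideal P (ring_on D) \<longleftrightarrow> ideal P (ring_on D) \<and> 1 \<notin> P \<and>
     (\<forall>x\<in>D. \<forall>y\<in>D. x * y \<in> P \<longrightarrow> x \<in> P \<or> y \<in> P)" (is "_ \<longleftrightarrow> ?R")
proof
  assume "primeideal P (ring_on D)"
  then interpret P: primeideal P "ring_on D" .
  have "1 \<notin> P"
    using P.one_imp_carrier P.I_notcarr by auto
  then show ?R
    using P.I_prime P.is_ideal by simp
next
  assume ?R
  then show "primeideal P (ring_on D)"
    by (intro primeidealI cring_ring_on) auto
qed

lemma primeideal_power:
  assumes "primeideal P (ring_on D)" "x \<in> D" "x ^ n \<in> P"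
  shows "x \<in> P"
  using assms(3)
proof (induction n)
  case (Suc n)
  then show ?case using assms(1,2) power_mem[of x n] by (auto simp: primeideal_iff)
qed (use assms(1) in \<open>simp add: primeideal_iff\<close>)

lemma primeideal_dvd:
  assumes "primeideal P (ring_on D)" "x \<in> P" "x dvd\<^sub>D y"
  shows "y \<in> P"
  using assms by (auto simp: primeideal_iff ideal_iff divides_in_def mult.commute)

lemma ideal_scaled_set: "a \<in> D \<Longrightarrow> ideal (scaled_set a D) (ring_on D)"
  by (auto simp: scaled_set_eq ideal_iff intro: dvd_add dvd_mult2 dvd_mem)

lemma primary_element_iff:
  "primary_element D x \<longleftrightarrow> x \<in> nonzero_nonunits D \<and>
     (\<forall>a\<in>D. \<forall>b\<in>D. x dvd\<^sub>D a * b \<longrightarrow> x dvd\<^sub>D a \<or> (\<exists>n\<ge>1. x dvd\<^sub>D b ^ n))"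
proof -
  have "scaled_set x D \<noteq> D" if "x \<in> nonzero_nonunits D"
  proof
    assume "scaled_set x D = D"
    then have "1 \<in> scaled_set x D" by simp
    then show False using that by (simp add: scaled_set_eq nonzero_nonunits_iff)
  qed
  then show ?thesis
    unfolding primary_element_def primary_ideal_def
    using ideal_scaled_set by (auto simp: scaled_set_eq nonzero_nonunits_iff)
qed

lemma archimedean_iff:
  "archimedean D \<longleftrightarrow> (\<forall>x\<in>nonzero_nonunits D. \<forall>y. (\<forall>n. x ^ n dvd\<^sub>D y) \<longrightarrow> y = 0)" (is "_ \<longleftrightarrow> ?R")
proof
  assume A: "archimedean D"
  show ?R
  proof (intro ballI allI impI)
    fix x y assume x: "x \<in> nonzero_nonunits D" and y: "\<forall>n. x ^ n dvd\<^sub>D y"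
    then have "(\<Inter>n\<in>{1::nat..}. scaled_set (x ^ n) D) = {0}"
      using A by (auto simp: archimedean_def nonzero_nonunits_def)
    moreover have "y \<in> (\<Inter>n\<in>{1::nat..}. scaled_set (x ^ n) D)"
      using y by (simp add: scaled_set_eq)
    ultimately show "y = 0" by simp
  qed
next
  assume R: ?R
  show "archimedean D"
    unfolding archimedean_def
  proof (intro ballI impI equalityI subsetI)
    fix x y assume x: "x \<in> D" "x \<notin> Units (ring_on D)"
      and y: "y \<in> (\<Inter>n\<in>{1::nat..}. scaled_set (x ^ n) D)"
    have n: "x ^ n dvd\<^sub>D y" if "n \<ge> 1" for n using y that by (auto simp: scaled_set_eq)
    have all: "x ^ n dvd\<^sub>D y" for n
      using n[of "Suc n"] power_dvd_power[OF x(1), of n "Suc n"] dvd_trans[of "x ^ n" "x ^ Suc n" y] by auto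
    show "y \<in> {0}"
    proof (cases "x = 0")
      case True
      then show ?thesis using n[of 1] by (auto simp: divides_in_def)
    next
      case False
      then have "x \<in> nonzero_nonunits D" using x by (simp add: nonzero_nonunits_def)
      then show ?thesis using R all by blast
    qed
  qed (auto simp: scaled_set_eq)
qed

lemma GCD_domain_if_gcd:
  assumes "domain_with_quotient_field D"
    and gcd: "\<And>a b. \<lbrakk>a \<in> D; b \<in> D; a \<noteq> 0; b \<noteq> 0\<rbrakk> \<Longrightarrow>
      \<exists>g\<in>D. g dvd\<^sub>D a \<and> g dvd\<^sub>D b \<and> (\<forall>d\<in>D. d dvd\<^sub>D a \<and> d dvd\<^sub>D b \<longrightarrow> d dvd\<^sub>D g)"
  shows "GCD_domain D"
proof -
  interpret R: domain "ring_on D" by (rule domain_ring_on)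
  have dvd: "x divides\<^bsub>mult_of (ring_on D)\<^esub> y \<longleftrightarrow> x dvd\<^sub>D y" if "y \<noteq> 0" for x y
    using that by (auto simp: factor_def divides_in_def)
  have "gcd_condition_monoid (mult_of (ring_on D))"
  proof
    fix a b assume "a \<in> carrier (mult_of (ring_on D))" "b \<in> carrier (mult_of (ring_on D))"
    then have ab: "a \<in> D" "b \<in> D" "a \<noteq> 0" "b \<noteq> 0" by auto
    then obtain g where g: "g \<in> D" "g dvd\<^sub>D a" "g dvd\<^sub>D b"
      "\<And>d. \<lbrakk>d \<in> D; d dvd\<^sub>D a; d dvd\<^sub>D b\<rbrakk> \<Longrightarrow> d dvd\<^sub>D g" using gcd by meson
    moreover have "g \<noteq> 0" using g(2) ab by (auto simp: divides_in_def)
    ultimately show "\<exists>c. c \<in> carrier (mult_of (ring_on D)) \<and> c gcdof\<^bsub>mult_of (ring_on D)\<^esub> a b"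
      using ab by (intro exI[of _ g]) (auto simp: isgcd_def dvd)
  qed
  then show ?thesis using assms(1) by (simp add: GCD_domain_def)
qed

end

section \<open>Radicals, coprimality and primary elements\<close>

context subring_of_field
begin

definition radical :: "'k \<Rightarrow> 'k set"
  where "radical a = {x \<in> D. \<exists>n. a dvd\<^sub>D x ^ n}"

lemma radicalI: "x \<in> D \<Longrightarrow> a dvd\<^sub>D x ^ n \<Longrightarrow> x \<in> radical a"
  by (auto simp: radical_def)

lemma radical_subset: "radical a \<subseteq> D"
  by (auto simp: radical_def)

lemma dvd_imp_mem_radical: "x \<in> D \<Longrightarrow> a dvd\<^sub>D x \<Longrightarrow> x \<in> radical a"
  using radicalI[of x a 1] by simp

lemma zero_mem_radical [simp]: "0 \<in> radical a"
  by (simp add: dvd_imp_mem_radical)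

lemma one_mem_radical_iff [simp]: "1 \<in> radical a \<longleftrightarrow> a dvd\<^sub>D 1"
  by (auto simp: radical_def)

lemma radical_trans:
  assumes "b \<in> radical a" shows "radical b \<subseteq> radical a"
proof
  fix x assume "x \<in> radical b"
  then obtain m n where "x \<in> D" "b dvd\<^sub>D x ^ n" "a dvd\<^sub>D b ^ m"
    using assms by (auto simp: radical_def)
  then show "x \<in> radical a"
    using dvd_power_mono[of b "x ^ n" m] dvd_trans[of a "b ^ m" "x ^ (n * m)"]
    by (auto simp: power_mult[symmetric] intro: radicalI)
qed

lemma radical_subset_primeideal:
  assumes "primeideal P (ring_on D)" "a \<in> P" shows "radical a \<subseteq> P"
  using assms primeideal_power primeideal_dvd unfolding radical_def by blast

text \<open>
  For nonzero \<open>a\<close> and \<open>b\<close> this says that \<open>aD \<inter> bD = abD\<close>, or that the v-closure of the ideal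
  \<open>(a, b)\<close> is \<open>D\<close>.
\<close>

definition v_coprime :: "'k \<Rightarrow> 'k \<Rightarrow> bool"
  where "v_coprime a b \<longleftrightarrow> (\<forall>z\<in>D. a dvd\<^sub>D b * z \<longrightarrow> a dvd\<^sub>D z)"

lemma v_coprimeD: "v_coprime a b \<Longrightarrow> z \<in> D \<Longrightarrow> a dvd\<^sub>D b * z \<Longrightarrow> a dvd\<^sub>D z"
  by (auto simp: v_coprime_def)

lemma v_coprime_sym:
  assumes "v_coprime a b" "a \<noteq> 0" "b \<in> D" shows "v_coprime b a"
  unfolding v_coprime_def
proof (intro ballI impI)
  fix z assume z: "z \<in> D" "b dvd\<^sub>D a * z"
  from z(2) obtain w where w: "w \<in> D" "a * z = b * w" by (rule dvdE)
  have "a dvd\<^sub>D b * w" using dvdI[OF z(1), of a] w(2) by simp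
  then have "a dvd\<^sub>D w" using v_coprimeD[OF assms(1) w(1)] by simp
  then obtain u where u: "u \<in> D" "w = a * u" by (rule dvdE)
  then have "a * z = a * (b * u)" using w(2) by (simp add: ac_simps)
  then have "z = b * u" using \<open>a \<noteq> 0\<close> by simp
  then show "b dvd\<^sub>D z" using dvdI[OF u(1)] by simp
qed

lemma v_coprime_unit: "u dvd\<^sub>D 1 \<Longrightarrow> v_coprime u b"
  unfolding v_coprime_def using dvd_trans[of u 1] by simp

lemma v_coprime_power_right:
  assumes "v_coprime a b" "b \<in> D" shows "v_coprime a (b ^ n)"
proof (induction n)
  case (Suc n)
  show ?case
    unfolding v_coprime_def
  proof (intro ballI impI)
    fix z assume z: "z \<in> D" "a dvd\<^sub>D b ^ Suc n * z"
    then have "a dvd\<^sub>D b * (b ^ n * z)" by (simp add: mult.assoc)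
    then have "a dvd\<^sub>D b ^ n * z"
      using v_coprimeD[OF assms(1)] mult_mem power_mem assms(2) z(1) by blast
    then show "a dvd\<^sub>D z" using v_coprimeD[OF Suc z(1)] by simp
  qed
qed (simp add: v_coprime_def)

lemma v_coprime_mult_left:
  assumes "v_coprime a b" "v_coprime c b" "a \<in> D" "b \<in> D" "c \<in> D" "a \<noteq> 0"
  shows "v_coprime (a * c) b"
  unfolding v_coprime_def
proof (intro ballI impI)
  fix z assume z: "z \<in> D" and ac: "a * c dvd\<^sub>D b * z"
  then have "a dvd\<^sub>D b * z" using dvdI[OF \<open>c \<in> D\<close>] dvd_trans by blast
  then obtain w where w: "w \<in> D" "z = a * w"
    using v_coprimeD[OF assms(1) z] by (auto elim: dvdE)
  have "a * c dvd\<^sub>D a * (b * w)" using ac w(2) by (simp add: ac_simps)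
  then have "c dvd\<^sub>D b * w" using dvd_mult_cancel[OF \<open>a \<noteq> 0\<close>] by simp
  then have "c dvd\<^sub>D w" using v_coprimeD[OF assms(2) w(1)] by simp
  then show "a * c dvd\<^sub>D z" using w(2) dvd_mult_cancel[OF \<open>a \<noteq> 0\<close>] by simp
qed

lemma v_coprime_power:
  assumes "v_coprime a b" "a \<in> D" "b \<in> D" "a \<noteq> 0"
  shows "v_coprime (a ^ n) (b ^ n)"
proof -
  have "v_coprime (a ^ m) (b ^ n)" for m
  proof (induction m)
    case (Suc m)
    then show ?case
      using v_coprime_mult_left[OF v_coprime_power_right[OF assms(1,3), of n] Suc] assms power_mem
      by simp
  qed (simp add: v_coprime_unit)
  then show ?thesis .
qed

lemma v_coprime_divisor_right:
  assumes "v_coprime a (b * c)" "b \<in> D" shows "v_coprime a c"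
  unfolding v_coprime_def
proof (intro ballI impI)
  fix z assume "z \<in> D" "a dvd\<^sub>D c * z"
  then show "a dvd\<^sub>D z"
    using assms dvd_mult2[of a "c * z" b] v_coprimeD[OF assms(1), of z] by (simp add: mult.assoc)
qed

text \<open>
  For nonzero \<open>x\<close> the factor \<open>g\<close> is a greatest common divisor whose cofactors are not just without
  common nonunit divisors but \<open>v_coprime\<close>.  This stronger property passes to products, so such \<open>g\<close>
  can be assembled factor by factor; with bare greatest common divisors that fails, because in a
  general domain \<open>ga\<close> and \<open>gb\<close> need not have one when \<open>a\<close> and \<open>b\<close> do.
\<close>

definition coprime_split :: "'k \<Rightarrow> 'k \<Rightarrow> bool"
  where "coprime_split x y \<longleftrightarrow>
    (\<exists>g\<in>D. \<exists>x'\<in>D. \<exists>y'\<in>D. x = g * x' \<and> y = g * y' \<and> v_coprime x' y')"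

lemma coprime_splitI:
  "\<lbrakk>g \<in> D; x' \<in> D; y' \<in> D; x = g * x'; y = g * y'; v_coprime x' y'\<rbrakk> \<Longrightarrow> coprime_split x y"
  by (auto simp: coprime_split_def)

lemma coprime_splitE:
  assumes "coprime_split x y"
  obtains g x' y' where "g \<in> D" "x' \<in> D" "y' \<in> D" "x = g * x'" "y = g * y'" "v_coprime x' y'"
  using assms by (auto simp: coprime_split_def)

lemma coprime_split_sym:
  assumes "coprime_split x y" "x \<noteq> 0" shows "coprime_split y x"
proof -
  obtain g x' y' where g: "g \<in> D" "x' \<in> D" "y' \<in> D" "x = g * x'" "y = g * y'" "v_coprime x' y'"
    using assms(1) by (rule coprime_splitE)
  moreover have "v_coprime y' x'" by (rule v_coprime_sym) (use g assms(2) in auto)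
  ultimately show ?thesis by (intro coprime_splitI)
qed

lemma coprime_split_dvd:
  assumes "a dvd\<^sub>D b" "a \<in> D" shows "coprime_split a b"
proof -
  obtain c where "c \<in> D" "b = a * c" using assms(1) by (rule dvdE)
  then show ?thesis
    using assms(2) by (intro coprime_splitI[of a 1 c]) (auto simp: v_coprime_unit)
qed

lemma coprime_split_mult:
  assumes "g \<in> D" "a \<in> D" "b \<in> D" "a \<noteq> 0" "v_coprime a b" and "coprime_split x b"
  shows "coprime_split (g * a * x) (g * b)"
proof -
  obtain h x' b' where h: "h \<in> D" "x' \<in> D" "b' \<in> D" "x = h * x'" "b = h * b'" "v_coprime x' b'"
    using assms(6) by (rule coprime_splitE)
  have "v_coprime a b'" using assms(5) h by (auto intro: v_coprime_divisor_right)
  then have "v_coprime (a * x') b'"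
    using h assms by (intro v_coprime_mult_left) auto
  then show ?thesis
    using h assms by (intro coprime_splitI[of "g * h" "a * x'" b']) (auto simp: ac_simps mult_mem)
qed

lemma gcd_if_coprime_split:
  assumes "coprime_split x y" "x \<noteq> 0"
  shows "\<exists>g\<in>D. g dvd\<^sub>D x \<and> g dvd\<^sub>D y \<and> (\<forall>d\<in>D. d dvd\<^sub>D x \<and> d dvd\<^sub>D y \<longrightarrow> d dvd\<^sub>D g)"
proof -
  obtain g x' y' where g: "g \<in> D" "x' \<in> D" "y' \<in> D" "x = g * x'" "y = g * y'" "v_coprime x' y'"
    using assms(1) by (rule coprime_splitE)
  have "d dvd\<^sub>D g" if d: "d dvd\<^sub>D x" "d dvd\<^sub>D y" for d
  proof -
    obtain e where e: "e \<in> D" "x = d * e" using d(1) by (rule dvdE)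
    obtain f where f: "f \<in> D" "y = d * f" using d(2) by (rule dvdE)
    have "d * (x' * f) = d * (y' * e)"
      using e f g by (metis mult.assoc mult.commute)
    then have "x' * f = y' * e" using e(2) assms(2) by auto
    then have "x' dvd\<^sub>D y' * e" using dvdI[OF f(1), of x'] by simp
    then have "x' dvd\<^sub>D e" using v_coprimeD[OF g(6) e(1)] by simp
    then obtain e' where e': "e' \<in> D" "e = x' * e'" by (rule dvdE)
    then have "x' * g = x' * (d * e')" using e(2) g(4) by (simp add: ac_simps)
    then have "g = d * e'" using g(4) assms(2) by auto
    then show ?thesis using dvdI[OF e'(1)] by simp
  qed
  then show ?thesis using g dvdI by blast
qed

lemma primary_mult_mem_radical:
  assumes "primary_element D p" "x \<in> D" "y \<in> D" "x * y \<in> radical p"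
  shows "x \<in> radical p \<or> y \<in> radical p"
proof -
  obtain n where "p dvd\<^sub>D x ^ n * y ^ n"
    using assms(4) by (auto simp: radical_def power_mult_distrib)
  then have "p dvd\<^sub>D x ^ n \<or> (\<exists>m\<ge>1. p dvd\<^sub>D (y ^ n) ^ m)"
    using assms(1-3) power_mem by (auto simp: primary_element_iff)
  then show ?thesis
    using assms(2,3) by (auto simp: power_mult[symmetric] intro: radicalI)
qed

text \<open>
  If \<open>x\<close> were not in \<open>radical y\<close>, then \<open>y\<close>, being primary, would divide \<open>z\<close> whenever it divides
  \<open>x * z\<close>.  An equation \<open>y\<^sup>n = x * z\<close> could then be divided by \<open>y\<close> again and again, until \<open>x\<close> divides
  \<open>1\<close>.
\<close>

lemma primary_radical_sym:
  assumes x: "primary_element D x" and y: "primary_element D y" and yx: "y \<in> radical x"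
  shows "x \<in> radical y"
proof (rule ccontr)
  assume not: "x \<notin> radical y"
  have xD: "x \<in> D" and yD: "y \<in> D" "y \<noteq> 0"
    using x y by (auto simp: primary_element_iff nonzero_nonunits_iff)
  have cancel: "y dvd\<^sub>D z" if "z \<in> D" "y dvd\<^sub>D x * z" for z
  proof -
    have "y dvd\<^sub>D z * x" using that by (simp add: mult.commute)
    then have "y dvd\<^sub>D z \<or> (\<exists>n\<ge>1. y dvd\<^sub>D x ^ n)"
      using y that(1) xD unfolding primary_element_iff by blast
    then show ?thesis using not radicalI xD by blast
  qed
  have "\<not> x dvd\<^sub>D y ^ n" for n
  proof (induction n)
    case 0
    then show ?case using x by (simp add: primary_element_iff nonzero_nonunits_iff)
  next
    case (Suc n)
    show ?case
    proof
      assume "x dvd\<^sub>D y ^ Suc n"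
      then obtain z where z: "z \<in> D" "y ^ Suc n = x * z" by (rule dvdE)
      have "y dvd\<^sub>D x * z" using z(2)[symmetric] dvdI[OF power_mem[OF yD(1)]] by simp
      then obtain w where w: "w \<in> D" "z = y * w" using cancel[OF z(1)] by (auto elim: dvdE)
      then have "y * y ^ n = y * (x * w)" using z(2) by (simp add: ac_simps)
      then have "y ^ n = x * w" using yD(2) by simp
      then show False using Suc dvdI[OF w(1)] by simp
    qed
  qed
  then show False using yx by (auto simp: radical_def)
qed

text \<open>
  A factor \<open>y\<close> outside \<open>radical p\<close> is absorbed into \<open>r\<close>, as \<open>radical p\<close> is prime.  A factor inside
  divides some \<open>p\<^sup>m\<close> by the symmetry of radicals, so it accounts for at most \<open>m\<close> factors \<open>p\<close>.
\<close>

lemma primary_power_dvd_bounded: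
  assumes p: "primary_element D p" and ys: "\<forall>y\<in>set ys. primary_element D y"
  shows "\<exists>N. \<forall>r\<in>D - radical p. \<forall>k. p ^ k dvd\<^sub>D prod_list ys * r \<longrightarrow> k \<le> N"
  using ys
proof (induction ys)
  case Nil
  have "k \<le> 0" if "r \<in> D - radical p" "p ^ k dvd\<^sub>D r" for r k
  proof (rule ccontr)
    assume "\<not> k \<le> 0"
    then have "p dvd\<^sub>D p ^ k"
      using power_dvd_power[of p 1 k] p by (auto simp: primary_element_iff nonzero_nonunits_iff)
    then show False using that dvd_trans dvd_imp_mem_radical by blast
  qed
  then show ?case by auto
next
  case (Cons y ys)
  then obtain N where N: "\<And>r k. \<lbrakk>r \<in> D; r \<notin> radical p; p ^ k dvd\<^sub>D prod_list ys * r\<rbrakk> \<Longrightarrow> k \<le> N"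
    by auto
  have D: "p \<in> D" "p \<noteq> 0" "y \<in> D" "set ys \<subseteq> D"
    using p Cons.prems by (auto simp: primary_element_iff nonzero_nonunits_iff)
  show ?case
  proof (cases "y \<in> radical p")
    case False
    have "k \<le> N" if r: "r \<in> D - radical p" "p ^ k dvd\<^sub>D prod_list (y # ys) * r" for r k
    proof (rule N)
      show "y * r \<in> D" using r D mult_mem by auto
      show "y * r \<notin> radical p" using primary_mult_mem_radical[OF p, of y r] False r D by auto
      show "p ^ k dvd\<^sub>D prod_list ys * (y * r)" using r(2) by (simp add: ac_simps)
    qed
    then show ?thesis by blast
  next
    case True
    then have "p \<in> radical y" using primary_radical_sym[OF p _ True] Cons.prems by simp
    then obtain m where m: "y dvd\<^sub>D p ^ m" by (auto simp: radical_def)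
    have "k \<le> N + m" if r: "r \<in> D - radical p" "p ^ k dvd\<^sub>D prod_list (y # ys) * r" for r k
    proof (cases "m \<le> k")
      case True
      have "prod_list (y # ys) * r dvd\<^sub>D p ^ m * (prod_list ys * r)"
        using dvd_mult_mono[OF m dvd_refl, of "prod_list ys * r"] by (simp add: ac_simps)
      then have "p ^ k dvd\<^sub>D p ^ m * (prod_list ys * r)" using r(2) dvd_trans by blast
      moreover have "p ^ k = p ^ m * p ^ (k - m)" using True by (simp flip: power_add)
      ultimately have "p ^ (k - m) dvd\<^sub>D prod_list ys * r"
        using dvd_mult_cancel[of "p ^ m"] D(2) by simp
      then have "k - m \<le> N" using N r(1) by blast
      then show ?thesis by simp
    qed simp
    then show ?thesis by blast
  qed
qed

text \<open>
  It is enough to bound the powers of one primary factor \<open>p\<close> of \<open>x\<close> that divide a given \<open>y\<close>.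
\<close>

lemma archimedean_if_weakly_factorial:
  assumes WF: "weakly_factorial D" shows "archimedean D"
  unfolding archimedean_iff
proof (intro ballI allI impI)
  fix x y assume x: "x \<in> nonzero_nonunits D" and xy: "\<forall>n. x ^ n dvd\<^sub>D y"
  have fac: "\<exists>ps. (\<forall>p\<in>set ps. primary_element D p) \<and> z = prod_list ps" if "z \<in> nonzero_nonunits D" for z
    using WF that by (simp add: weakly_factorial_def)
  have setD: "set ps \<subseteq> D" if "\<forall>p\<in>set ps. primary_element D p" for ps
    using that by (auto simp: primary_element_iff nonzero_nonunits_iff)
  obtain ps where ps: "\<forall>p\<in>set ps. primary_element D p" "x = prod_list ps" using fac x by blast
  then have "ps \<noteq> []" using x by (auto simp: nonzero_nonunits_iff)
  then obtain p where "p \<in> set ps" by (cases ps) auto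
  then have p: "primary_element D p" and px: "p dvd\<^sub>D x" using ps setD dvd_prod_list by auto
  have py: "p ^ n dvd\<^sub>D y" for n using xy dvd_power_mono[OF px] dvd_trans by blast
  have one: "1 \<in> D - radical p" using p by (simp add: primary_element_iff nonzero_nonunits_iff)
  show "y = 0"
  proof (rule ccontr)
    assume "y \<noteq> 0"
    have "y \<in> D" using py[of 0] by simp
    moreover have "\<not> y dvd\<^sub>D 1"
      using py[of 1] one dvd_trans by auto
    ultimately obtain ys where ys: "\<forall>p\<in>set ys. primary_element D p" "y = prod_list ys"
      using fac[of y] \<open>y \<noteq> 0\<close> by (auto simp: nonzero_nonunits_iff)
    obtain N where "\<And>k. p ^ k dvd\<^sub>D y \<Longrightarrow> k \<le> N"
      using primary_power_dvd_bounded[OF p ys(1)] one ys(2) by (metis mult_1_right)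
    from this[OF py[of "Suc N"]] show False by simp
  qed
qed


section \<open>Complete integral closedness\<close>

text \<open>
  A nonzero common multiple \<open>y\<close> of all powers of \<open>x\<close> is a denominator that makes \<open>inverse x\<close> almost
  integral, so \<open>x\<close> is a unit.
\<close>

lemma archimedean_if_completely_integrally_closed:
  assumes CIC: "completely_integrally_closed D" shows "archimedean D"
  unfolding archimedean_iff
proof (intro ballI allI impI)
  fix x y assume x: "x \<in> nonzero_nonunits D" and xy: "\<forall>n. x ^ n dvd\<^sub>D y"
  show "y = 0"
  proof (rule ccontr)
    assume "y \<noteq> 0"
    have "y * inverse x ^ n \<in> D" for n
    proof -
      obtain c where "c \<in> D" "y = x ^ n * c" using xy by (auto elim: dvdE)
      then show ?thesis using x by (simp add: nonzero_nonunits_iff power_inverse field_simps)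
    qed
    moreover have "y \<in> D" using xy[rule_format, of 0] by simp
    ultimately have "almost_integral D (inverse x)"
      using \<open>y \<noteq> 0\<close> by (auto simp: almost_integral_def)
    then have "inverse x \<in> D" using CIC by (simp add: completely_integrally_closed_def)
    then have "x dvd\<^sub>D x * inverse x" by (rule dvdI)
    then show False using x by (simp add: nonzero_nonunits_iff)
  qed
qed

text \<open>
  For \<open>z = a / b\<close> in lowest terms, \<open>c * z\<^sup>n \<in> D\<close> says that \<open>b\<^sup>n\<close> divides \<open>a\<^sup>n * c\<close> and thus \<open>c\<close>.  In an
  archimedean domain only a unit \<open>b\<close> has all its powers dividing \<open>c\<close>.
\<close>

lemma completely_integrally_closed_if_coprime_split:
  assumes dom: "domain_with_quotient_field D" and arch: "archimedean D"
    and split: "\<And>x y. \<lbrakk>x \<in> D; y \<in> D; x \<noteq> 0; y \<noteq> 0\<rbrakk> \<Longrightarrow> coprime_split x y"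
  shows "completely_integrally_closed D"
  unfolding completely_integrally_closed_def
proof (intro allI impI)
  fix z assume "almost_integral D z"
  then obtain c where c: "c \<in> D" "c \<noteq> 0" "\<And>n. n \<ge> 1 \<Longrightarrow> c * z ^ n \<in> D"
    by (auto simp: almost_integral_def)
  obtain x y where xy: "x \<in> D" "y \<in> D" "y \<noteq> 0" "z = x / y"
    using dom unfolding domain_with_quotient_field_def by meson
  show "z \<in> D"
  proof (cases "x = 0")
    case False
    then obtain g a b where g: "g \<in> D" "b \<in> D" "a \<in> D" "y = g * b" "x = g * a" "v_coprime b a"
      using split[of y x] xy by (auto elim: coprime_splitE)
    have b0: "b \<noteq> 0" and z: "z = a / b" using g xy by auto
    have "b ^ n dvd\<^sub>D c" for n
    proof -
      have "c * z ^ n \<in> D" using c by (cases "n = 0") auto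
      moreover have "a ^ n * c = b ^ n * (c * z ^ n)" using b0 z by (simp add: power_divide)
      ultimately have "b ^ n dvd\<^sub>D a ^ n * c" by (metis dvdI)
      then show ?thesis
        using v_coprimeD[OF v_coprime_power[OF g(6) g(2,3) b0]] c(1) by simp
    qed
    then have "b \<notin> nonzero_nonunits D" using arch c(2) unfolding archimedean_iff by metis
    then have "b dvd\<^sub>D 1" using g(2) b0 by (simp add: nonzero_nonunits_iff)
    then obtain u where "u \<in> D" "1 = b * u" by (rule dvdE)
    then have "u = inverse b" using inverse_unique[of b u] by simp
    then have "z = a * u" using z by (simp add: divide_inverse)
    then show ?thesis using g(3) \<open>u \<in> D\<close> mult_mem by simp
  qed (use xy in simp)
qed


section \<open>Prime t-ideals, the t-dimension and heights\<close>

definition span_on :: "'k set \<Rightarrow> 'k set"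
  where "span_on S = {\<Sum>s\<in>S. c s * s | c. \<forall>s\<in>S. c s \<in> D}"

lemma generator_mem_span:
  assumes "finite S" "x \<in> S" shows "x \<in> span_on S"
proof -
  have "x = (\<Sum>s\<in>S. (if s = x then 1 else 0) * s)"
    using assms by (simp add: if_distrib[of "\<lambda>c. c * _"] cong: if_cong)
  then show ?thesis
    unfolding span_on_def by (intro CollectI exI[of _ "\<lambda>s. if s = x then 1 else 0"]) simp
qed

lemma span_subset_ideal:
  assumes "ideal I (ring_on D)" "S \<subseteq> I" shows "span_on S \<subseteq> I"
proof
  fix x assume "x \<in> span_on S"
  then obtain c where c: "x = (\<Sum>s\<in>S. c s * s)" "\<forall>s\<in>S. c s \<in> D" by (auto simp: span_on_def)
  have "(\<Sum>s\<in>T. c s * s) \<in> I" if "T \<subseteq> S" for T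
    using that assms c(2) by (induction T rule: infinite_finite_induct) (auto simp: ideal_iff)
  then show "x \<in> I" using c(1) by blast
qed

lemma span_ideal:
  assumes "S \<subseteq> D" shows "ideal (span_on S) (ring_on D)"
  unfolding ideal_iff
proof (intro conjI ballI)
  show "span_on S \<subseteq> D"
    using assms by (auto simp: span_on_def intro!: sum_mem mult_mem)
  show "0 \<in> span_on S"
    unfolding span_on_def by (intro CollectI exI[of _ "\<lambda>_. 0"]) simp
next
  fix x y assume "x \<in> span_on S" "y \<in> span_on S"
  then obtain c d where "x = (\<Sum>s\<in>S. c s * s)" "\<forall>s\<in>S. c s \<in> D" "y = (\<Sum>s\<in>S. d s * s)" "\<forall>s\<in>S. d s \<in> D"
    by (auto simp: span_on_def)
  then show "x + y \<in> span_on S"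
    unfolding span_on_def
    by (intro CollectI exI[of _ "\<lambda>s. c s + d s"]) (auto simp: distrib_right sum.distrib add_mem)
next
  fix x d assume "x \<in> span_on S" "d \<in> D"
  then obtain c where "x = (\<Sum>s\<in>S. c s * s)" "\<forall>s\<in>S. c s \<in> D"
    by (auto simp: span_on_def)
  then show "d * x \<in> span_on S"
    unfolding span_on_def using \<open>d \<in> D\<close>
    by (intro CollectI exI[of _ "\<lambda>s. d * c s"]) (auto simp: sum_distrib_left mult.assoc mult_mem)
qed

lemma nonzero_fg_fractional_ideal_span:
  assumes "finite S" "S \<subseteq> D" "s \<in> S" "s \<noteq> 0"
  shows "nonzero_fg_fractional_ideal D (span_on S)"
proof -
  have I: "span_on S \<subseteq> D" "0 \<in> span_on S" "\<forall>x\<in>span_on S. \<forall>y\<in>span_on S. x + y \<in> span_on S"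
      "\<forall>x\<in>span_on S. \<forall>c\<in>D. c * x \<in> span_on S"
    using span_ideal[OF assms(2)] by (auto simp: ideal_iff)
  interpret K: cring "ring_of_type_algebra :: 'k ring" by (rule cring_from_type_algebra)
  have "additive_subgroup (span_on S) ring_of_type_algebra"
  proof (rule additive_subgroupI, rule K.add.subgroupI)
    fix a assume a: "a \<in> span_on S"
    have "\<ominus>\<^bsub>ring_of_type_algebra\<^esub> a = (- 1) * a"
      by (rule K.minus_equality) (simp_all add: ring_of_type_algebra_def)
    moreover have "(- 1) * a \<in> span_on S" using I(4) a neg_mem one_mem by blast
    ultimately show "\<ominus>\<^bsub>ring_of_type_algebra\<^esub> a \<in> span_on S" by simp
  qed (use I in \<open>auto simp: ring_of_type_algebra_def\<close>)
  moreover have "span_on S \<noteq> {0}" using generator_mem_span[OF assms(1,3)] assms(4) by auto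
  moreover have "scaled_set 1 (span_on S) \<subseteq> D" using I(1) by (auto simp: scaled_set_def)
  ultimately have "nonzero_fractional_ideal D (span_on S)"
    using I(4) unfolding nonzero_fractional_ideal_def by (intro conjI bexI[of _ 1]) auto
  then show ?thesis
    using assms(1) unfolding nonzero_fg_fractional_ideal_def span_on_def by blast
qed

text \<open>
  If \<open>t\<close> divides the generators of \<open>I\<close>, then \<open>inverse t\<close> lies in the inverse of \<open>I\<close>, so the v-closure
  of \<open>I\<close> stays within \<open>tD\<close> and therefore within \<open>P\<close>.
\<close>

lemma prime_t_idealI:
  assumes P: "primeideal P (ring_on D)" "P \<noteq> {0}"
    and div: "\<And>S. finite S \<Longrightarrow> S \<subseteq> P \<Longrightarrow> \<exists>t\<in>P. t \<noteq> 0 \<and> (\<forall>s\<in>S. t dvd\<^sub>D s)"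
  shows "prime_t_ideal D P"
proof -
  have PD: "P \<subseteq> D" "0 \<in> P" and idP: "ideal P (ring_on D)" using P(1) by (auto simp: primeideal_iff ideal_iff)
  have "t_closure D P \<subseteq> P"
  proof
    fix x assume "x \<in> t_closure D P"
    then obtain I where I: "x \<in> v_closure D I" "I \<subseteq> P" "nonzero_fg_fractional_ideal D I"
      by (auto simp: t_closure_def)
    then obtain S where S: "finite S" "I = span_on S"
      by (auto simp: nonzero_fg_fractional_ideal_def span_on_def)
    then have "S \<subseteq> P" using generator_mem_span I(2) by auto
    then obtain t where t: "t \<in> P" "t \<noteq> 0" "\<forall>s\<in>S. t dvd\<^sub>D s" using div S(1) by blast
    then have "I \<subseteq> scaled_set t D"
      unfolding S(2) using PD by (intro span_subset_ideal ideal_scaled_set) (auto simp: scaled_set_eq)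
    then have "inverse t \<in> inverse_ideal D I"
      using t(2) by (auto simp: inverse_ideal_def scaled_set_def mult.assoc[symmetric])
    then have "x * inverse t \<in> D" using I(1) by (auto simp: v_closure_def inverse_ideal_def scaled_set_def)
    then have "t dvd\<^sub>D t * (x * inverse t)" by (rule dvdI)
    then show "x \<in> P" using t primeideal_dvd[OF P(1), of t x] by (simp add: field_simps)
  qed
  moreover have "P \<subseteq> t_closure D P"
  proof
    fix x assume x: "x \<in> P"
    obtain p where p: "p \<in> P" "p \<noteq> 0" using P(2) PD by auto
    have "x \<in> v_closure D (span_on {x, p})"
      using generator_mem_span[of "{x, p}" x]
      by (auto simp: v_closure_def inverse_ideal_def scaled_set_def mult.commute)
    moreover have "span_on {x, p} \<subseteq> P" using x p by (intro span_subset_ideal[OF idP]) auto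
    moreover have "nonzero_fg_fractional_ideal D (span_on {x, p})"
      using x p PD by (intro nonzero_fg_fractional_ideal_span[of _ p]) auto
    ultimately show "x \<in> t_closure D P" unfolding t_closure_def by blast
  qed
  ultimately show ?thesis using P by (auto simp: prime_t_ideal_def)
qed

text \<open>
  The inverse of \<open>(a, b)\<close> is contained in \<open>D\<close> when \<open>a\<close> and \<open>b\<close> are coprime.  Its v-closure then contains
  \<open>1\<close>, although it ought to lie in the t-closed \<open>P\<close>.
\<close>

lemma prime_t_ideal_not_v_coprime:
  assumes P: "prime_t_ideal D P" and ab: "a \<in> P" "b \<in> P" "a \<noteq> 0"
  shows "\<not> v_coprime a b"
proof
  assume cop: "v_coprime a b"
  have prime: "primeideal P (ring_on D)" and closed: "t_closure D P = P"
    using P by (auto simp: prime_t_ideal_def)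
  then have id: "ideal P (ring_on D)" and PD: "P \<subseteq> D" by (auto simp: primeideal_iff ideal_iff)
  define I where "I = span_on {a, b}"
  have "inverse_ideal D I \<subseteq> D"
  proof
    fix x assume "x \<in> inverse_ideal D I"
    then have x: "x * a \<in> D" "x * b \<in> D"
      using generator_mem_span[of "{a, b}"] by (auto simp: I_def inverse_ideal_def scaled_set_def)
    have "a dvd\<^sub>D b * (x * a)" using dvdI[OF x(2), of a] by (simp add: ac_simps)
    then have "a dvd\<^sub>D x * a" using v_coprimeD[OF cop x(1)] by simp
    then show "x \<in> D" using ab(3) by (auto simp: divides_in_def)
  qed
  then have "1 \<in> v_closure D I" by (auto simp: v_closure_def inverse_ideal_def scaled_set_def)
  moreover have "I \<subseteq> P" unfolding I_def using ab by (intro span_subset_ideal[OF id]) auto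
  moreover have "nonzero_fg_fractional_ideal D I"
    unfolding I_def using ab PD by (intro nonzero_fg_fractional_ideal_span[of _ a]) auto
  ultimately have "1 \<in> t_closure D P" unfolding t_closure_def by blast
  then show False using closed prime by (simp add: primeideal_iff)
qed

lemma t_dim_eq_1I:
  assumes "prime_t_ideal D P" and "\<And>P Q. \<lbrakk>prime_t_ideal D P; prime_t_ideal D Q\<rbrakk> \<Longrightarrow> \<not> P \<subset> Q"
  shows "t_dim D = 1"
  unfolding t_dim_def
proof (rule antisym)
  show "Sup {enat (length Ps) |Ps. (\<forall>P\<in>set Ps. prime_t_ideal D P) \<and> sorted_wrt (\<subset>) Ps} \<le> 1"
  proof (rule Sup_least, clarify)
    fix Ps assume Ps: "\<forall>P\<in>set Ps. prime_t_ideal D P" "sorted_wrt (\<subset>) Ps"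
    \<comment> \<open>The case rule serves only to separate lists of length 0, 1 and at least 2.\<close>
    have "length Ps \<le> 1"
    proof (cases Ps rule: remdups_adj.cases)
      case (3 P Q Qs)
      then show ?thesis using Ps assms(2)[of P Q] by auto
    qed auto
    then show "enat (length Ps) \<le> 1" by (simp add: one_enat_def)
  qed
  show "1 \<le> Sup {enat (length Ps) |Ps. (\<forall>P\<in>set Ps. prime_t_ideal D P) \<and> sorted_wrt (\<subset>) Ps}"
    by (rule Sup_upper, intro CollectI exI[of _ "[P]"]) (simp add: assms(1) one_enat_def)
qed

lemma t_dim_eq_1D:
  assumes "t_dim D = 1" "prime_t_ideal D P" "prime_t_ideal D Q"
  shows "\<not> P \<subset> Q"
proof
  assume "P \<subset> Q"
  then have "enat 2 \<le> t_dim D"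
    unfolding t_dim_def by (intro Sup_upper CollectI exI[of _ "[P, Q]"]) (simp add: assms)
  then show False using assms(1) by (simp add: one_enat_def)
qed

lemma primeideal_zero: "primeideal {0} (ring_on D)"
  by (auto simp: primeideal_iff ideal_iff)

lemma height_eq_1I:
  assumes "primeideal P (ring_on D)" "P \<noteq> {0}"
    and "\<And>Q. \<lbrakk>primeideal Q (ring_on D); Q \<noteq> {0}\<rbrakk> \<Longrightarrow> \<not> Q \<subset> P"
  shows "height D P = 1"
  unfolding height_def
proof (rule antisym)
  have zero: "0 \<in> Q" if "primeideal Q (ring_on D)" for Q
    using that by (auto simp: primeideal_iff ideal_iff)
  show "Sup {enat (length Ps) |Ps. (\<forall>Q\<in>set Ps. primeideal Q (ring_on D)) \<and> sorted_wrt (\<subset>) (Ps @ [P])} \<le> 1"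
  proof (rule Sup_least, clarify)
    fix Ps assume Ps: "\<forall>Q\<in>set Ps. primeideal Q (ring_on D)" "sorted_wrt (\<subset>) (Ps @ [P])"
    \<comment> \<open>In a list of at least two primes below \<open>P\<close> the second one is nonzero.\<close>
    have "length Ps \<le> 1"
    proof (cases Ps rule: remdups_adj.cases)
      case (3 Q R Qs)
      then have "Q \<subset> R" "R \<subset> P" "primeideal R (ring_on D)" "0 \<in> Q" using Ps zero by auto
      then show ?thesis using assms(3)[of R] by auto
    qed auto
    then show "enat (length Ps) \<le> 1" by (simp add: one_enat_def)
  qed
  show "1 \<le> Sup {enat (length Ps) |Ps. (\<forall>Q\<in>set Ps. primeideal Q (ring_on D)) \<and> sorted_wrt (\<subset>) (Ps @ [P])}"
    using zero[OF assms(1)] assms(2) primeideal_zero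
    by (intro Sup_upper CollectI exI[of _ "[{0}]"]) (auto simp: one_enat_def)
qed

lemma height_eq_1D:
  assumes "height D P = 1" "primeideal Q (ring_on D)" "Q \<noteq> {0}"
  shows "\<not> Q \<subset> P"
proof
  assume QP: "Q \<subset> P"
  have "0 \<in> Q" using assms(2) by (auto simp: primeideal_iff ideal_iff)
  then have "enat 2 \<le> height D P"
    unfolding height_def using QP assms primeideal_zero
    by (intro Sup_upper CollectI exI[of _ "[{0}, Q]"]) auto
  then show False using assms(1) by (simp add: one_enat_def)
qed

end

section \<open>Valuation elements\<close>

context subring_of_field
begin

text \<open>
  For nonzero \<open>a \<in> D\<close> the last conjunct is the condition \<open>aV \<inter> D = aD\<close> with \<open>a\<close> cancelled.
\<close>

definition valuation_witness :: "'k set \<Rightarrow> 'k \<Rightarrow> bool"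
  where "valuation_witness V a \<longleftrightarrow>
    overring D V \<and> valuation_domain V \<and> (\<forall>v\<in>V. a * v \<in> D \<longrightarrow> v \<in> D)"

lemma valuation_witness_overring:
  assumes "valuation_witness V a" shows "subring_of_field V" "D \<subseteq> V"
  using assms by (auto simp: valuation_witness_def overring_def subring_of_field_def)

lemma valuation_witness_total:
  assumes "valuation_witness V a" "y \<noteq> 0" shows "x / y \<in> V \<or> y / x \<in> V"
proof (cases "x = 0")
  case False
  then have "x / y \<in> V \<or> inverse (x / y) \<in> V"
    using assms unfolding valuation_witness_def valuation_domain_def by (metis divide_eq_0_iff)
  then show ?thesis by simp
qed (use valuation_witness_overring[OF assms(1)] in auto)

lemma valuation_witness_dvd:
  "valuation_witness V a \<Longrightarrow> v \<in> V \<Longrightarrow> a * v \<in> D \<Longrightarrow> a dvd\<^sub>D a * v"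
  by (simp add: valuation_witness_def dvdI)

lemma valuation_element_iff:
  "valuation_element D a \<longleftrightarrow> a \<in> nonzero_nonunits D \<and> (\<exists>V. valuation_witness V a)"
proof -
  have "scaled_set a V \<inter> D = scaled_set a D \<longleftrightarrow> (\<forall>v\<in>V. a * v \<in> D \<longrightarrow> v \<in> D)"
    if "a \<in> nonzero_nonunits D" "overring D V" for V
  proof -
    have "a \<in> D" "a \<noteq> 0" "D \<subseteq> V" using that by (auto simp: nonzero_nonunits_iff overring_def)
    then have "scaled_set a D \<subseteq> scaled_set a V \<inter> D"
      and mem: "a * v \<in> scaled_set a D \<longleftrightarrow> v \<in> D" for v
      by (auto simp: scaled_set_def mult_mem)
    then have "scaled_set a V \<inter> D = scaled_set a D \<longleftrightarrow> (\<forall>x\<in>scaled_set a V. x \<in> D \<longrightarrow> x \<in> scaled_set a D)"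
      by blast
    also have "\<dots> \<longleftrightarrow> (\<forall>v\<in>V. a * v \<in> D \<longrightarrow> a * v \<in> scaled_set a D)"
      by (auto simp: scaled_set_def[of a V])
    finally show ?thesis by (simp only: mem)
  qed
  then show ?thesis by (auto simp: valuation_element_def valuation_witness_def)
qed

lemma valuation_elementD:
  assumes "valuation_element D a" shows "a \<in> D" "a \<noteq> 0" "\<not> a dvd\<^sub>D 1"
  using assms by (auto simp: valuation_element_def nonzero_nonunits_iff)

lemma valuation_witness_divisor:
  assumes "valuation_witness V a" "b dvd\<^sub>D a" shows "valuation_witness V b"
proof -
  obtain c where c: "c \<in> D" "a = b * c" using assms(2) by (rule dvdE)
  have "v \<in> D" if "v \<in> V" "b * v \<in> D" for v
  proof -
    have "a * v \<in> D" using mult_mem[OF c(1) that(2)] c(2) by (simp add: ac_simps)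
    then show ?thesis using assms(1) that(1) by (simp add: valuation_witness_def)
  qed
  then show ?thesis using assms(1) by (simp add: valuation_witness_def)
qed

text \<open>
  The factors \<open>a\<close> of \<open>a\<^sup>n * v \<in> D\<close> can be removed one at a time, since \<open>a\<^sup>k * v\<close> stays in \<open>V\<close>.
\<close>

lemma valuation_witness_power:
  assumes "valuation_witness V a" "a \<in> D" shows "valuation_witness V (a ^ n)"
proof -
  interpret V: subring_of_field V using valuation_witness_overring[OF assms(1)] by simp
  have aV: "a \<in> V" using valuation_witness_overring[OF assms(1)] assms(2) by blast
  have "v \<in> D" if "v \<in> V" "a ^ n * v \<in> D" for v
    using that(2)
  proof (induction n)
    case (Suc n)
    have "a ^ n * v \<in> V" using aV that(1) V.mult_mem V.power_mem by simp
    moreover have "a * (a ^ n * v) \<in> D" using Suc.prems by (simp add: mult.assoc)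
    ultimately show ?case using Suc.IH assms(1) by (simp add: valuation_witness_def)
  qed simp
  then show ?thesis using assms(1) by (simp add: valuation_witness_def)
qed

lemma valuation_element_divisor:
  assumes "valuation_element D a" "b dvd\<^sub>D a" "b \<in> D" "\<not> b dvd\<^sub>D 1"
  shows "valuation_element D b"
proof -
  have "b \<noteq> 0" using assms(2) valuation_elementD(2)[OF assms(1)] by (auto simp: divides_in_def)
  then show ?thesis
    using assms valuation_witness_divisor by (auto simp: valuation_element_iff nonzero_nonunits_iff)
qed

lemma valuation_witness_dvd_total:
  assumes "valuation_witness V b" "b \<noteq> 0" "x \<in> D"
  shows "b dvd\<^sub>D x \<or> b / x \<in> V"
  using valuation_witness_total[OF assms(1,2), of x] valuation_witness_dvd[OF assms(1), of "x / b"]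
    assms(2,3) by auto

text \<open>
  One of \<open>b / c\<close> and \<open>c / b\<close> lies in \<open>V\<close>, and because \<open>b\<close> and \<open>c\<close> inherit the overring \<open>V\<close> from
  \<open>a\<^sup>n\<close>, it lies in \<open>D\<close>.
\<close>

lemma power_divisors_comparable:
  assumes a: "valuation_element D a" and bc: "b dvd\<^sub>D a ^ n" "c dvd\<^sub>D a ^ n" "b \<in> D" "c \<in> D"
  shows "b dvd\<^sub>D c \<or> c dvd\<^sub>D b"
proof -
  obtain V where V: "valuation_witness V a" using a by (auto simp: valuation_element_iff)
  have wit: "valuation_witness V b" "valuation_witness V c"
    using valuation_witness_divisor[OF valuation_witness_power[OF V]] bc valuation_elementD[OF a] by auto
  have "b \<noteq> 0" "c \<noteq> 0" using bc valuation_elementD[OF a] by (auto simp: divides_in_def)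
  then show ?thesis
    using valuation_witness_dvd_total[OF wit(1), of c] valuation_witness_dvd[OF wit(2), of "b / c"] bc
    by auto
qed

text \<open>
  Of two nonzero elements one, say \<open>y\<close>, divides the other in \<open>V\<close>.  Then
  \<open>(x + y)\<^sup>n = y\<^sup>n * (x / y + 1)\<^sup>n\<close> and \<open>x\<^bsup>2n\<^esup> = (x * y)\<^sup>n * (x / y)\<^sup>n\<close> show that the ideal is closed under
  sums and prime: a multiple of \<open>a\<close> in \<open>V\<close> that belongs to \<open>D\<close> is a multiple of \<open>a\<close> in \<open>D\<close>.
\<close>

lemma valuation_radical_prime:
  assumes a: "valuation_element D a" shows "primeideal (radical a) (ring_on D)"
proof -
  obtain V where V: "valuation_witness V a" using a by (auto simp: valuation_element_iff)
  interpret V: subring_of_field V using valuation_witness_overring[OF V] by simp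
  have DV: "D \<subseteq> V" using valuation_witness_overring[OF V] by simp
  have mem: "x \<in> radical a" if "x \<in> D" "x ^ n = a * v" "v \<in> V" for x n v
    using valuation_witness_dvd[OF V that(3)] power_mem[OF that(1), of n] that(1,2)
      radicalI[of x a n] by simp
  have sum: "x + y \<in> radical a" if h: "x \<in> D" "y \<in> radical a" "y \<noteq> 0" "x / y \<in> V" for x y
  proof -
    obtain n where "a dvd\<^sub>D y ^ n" using h(2) by (auto simp: radical_def)
    then obtain d where d: "d \<in> D" "y ^ n = a * d" by (rule dvdE)
    have "x + y = y * (x / y + 1)" using h(3) by (simp add: field_simps)
    then have "(x + y) ^ n = a * (d * (x / y + 1) ^ n)" using d(2) by (simp add: power_mult_distrib)
    moreover have "d * (x / y + 1) ^ n \<in> V"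
      using d(1) DV h(4) by (auto intro!: V.mult_mem V.power_mem V.add_mem)
    ultimately show ?thesis using h(1,2) add_mem by (intro mem) (auto simp: radical_def)
  qed
  have prod: "x \<in> radical a" if h: "x \<in> D" "x * y \<in> radical a" "y \<noteq> 0" "x / y \<in> V" for x y
  proof -
    obtain n where "a dvd\<^sub>D (x * y) ^ n" using h(2) by (auto simp: radical_def)
    then obtain d where d: "d \<in> D" "(x * y) ^ n = a * d" by (rule dvdE)
    have "x ^ (2 * n) = (x * y * (x / y)) ^ n" using h(3) by (simp add: power_mult power2_eq_square)
    then have "x ^ (2 * n) = a * (d * (x / y) ^ n)" by (subst (asm) power_mult_distrib) (simp add: d(2))
    moreover have "d * (x / y) ^ n \<in> V"
      using d(1) DV h(4) by (auto intro!: V.mult_mem V.power_mem)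
    ultimately show ?thesis using mem h(1) by blast
  qed
  have scale: "c * x \<in> radical a" if h: "x \<in> radical a" "c \<in> D" for c x
  proof -
    obtain n where n: "x \<in> D" "a dvd\<^sub>D x ^ n" using h(1) by (auto simp: radical_def)
    then have "a dvd\<^sub>D (c * x) ^ n" using h(2) by (simp add: power_mult_distrib dvd_mult2 power_mem)
    then show ?thesis using n(1) h(2) mult_mem radicalI by simp
  qed
  have "x + y \<in> radical a" if xy: "x \<in> radical a" "y \<in> radical a" for x y
  proof (cases "x = 0 \<or> y = 0")
    case False
    then show ?thesis
      using sum[of x y] sum[of y x] valuation_witness_total[OF V, of y x] xy
      by (auto simp: radical_def add.commute)
  qed (use xy in auto)
  moreover have "x \<in> radical a \<or> y \<in> radical a" if xy: "x \<in> D" "y \<in> D" "x * y \<in> radical a" for x y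
  proof (cases "x = 0 \<or> y = 0")
    case False
    then show ?thesis
      using prod[of x y] prod[of y x] valuation_witness_total[OF V, of y x] xy
      by (auto simp: mult.commute)
  qed auto
  ultimately show ?thesis
    using scale valuation_elementD[OF a] radical_subset[of a]
    by (auto simp: primeideal_iff ideal_iff)
qed

text \<open>
  This ideal is the contraction of the intersection of the ideals \<open>a\<^sup>nV\<close>.  If \<open>a\<^sup>m\<close> does not divide \<open>x\<close>
  and \<open>a\<^sup>n\<close> does not divide \<open>y\<close>, then in \<open>V\<close> these divisibilities are reversed, and \<open>x * y\<close> divides
  \<open>a\<^bsup>m+n\<^esup>\<close>.  If \<open>x * y\<close> were a multiple of \<open>a\<^bsup>m+n+1\<^esup>\<close>, then \<open>a\<close> would be a unit.
\<close>

lemma valuation_powers_Inter_prime: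
  assumes a: "valuation_element D a"
  shows "primeideal {x. \<forall>n. a ^ n dvd\<^sub>D x} (ring_on D)" (is "primeideal ?Q _")
proof -
  have aD: "a \<in> D" "a \<noteq> 0" "\<not> a dvd\<^sub>D 1" using valuation_elementD[OF a] .
  obtain V where V: "valuation_witness V a" using a by (auto simp: valuation_element_iff)
  interpret V: subring_of_field V using valuation_witness_overring[OF V] by simp
  have DV: "D \<subseteq> V" using valuation_witness_overring[OF V] by simp
  have "?Q \<subseteq> D"
  proof
    fix x assume "x \<in> ?Q"
    then have "a ^ 0 dvd\<^sub>D x" by blast
    then show "x \<in> D" by simp
  qed
  then have "ideal ?Q (ring_on D)"
    unfolding ideal_iff by (auto intro: dvd_add dvd_mult2)
  moreover have "1 \<notin> ?Q" using aD(3) power_one_right[of a] by (metis mem_Collect_eq)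
  moreover have "x \<in> ?Q \<or> y \<in> ?Q" if xy: "x \<in> D" "y \<in> D" "x * y \<in> ?Q" for x y
  proof (rule ccontr)
    assume "\<not> (x \<in> ?Q \<or> y \<in> ?Q)"
    then obtain m n where mn: "\<not> a ^ m dvd\<^sub>D x" "\<not> a ^ n dvd\<^sub>D y" by blast
    then have "x \<noteq> 0" "y \<noteq> 0" by auto
    have "a ^ m / x \<in> V" "a ^ n / y \<in> V"
      using valuation_witness_dvd_total[OF valuation_witness_power[OF V aD(1)]] mn aD(2) xy by auto
    then have "a ^ m / x * (a ^ n / y) \<in> V" by (rule V.mult_mem)
    moreover have "a ^ (m + n + 1) dvd\<^sub>D x * y" using xy(3) by blast
    then obtain d where d: "d \<in> D" "x * y = a ^ (m + n + 1) * d" by (rule dvdE)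
    ultimately have dV: "d * (a ^ m / x * (a ^ n / y)) \<in> V" using DV V.mult_mem by blast
    have "a * (d * (a ^ m / x * (a ^ n / y))) = a ^ (m + n + 1) * d / (x * y)"
      by (simp add: power_add)
    also have "\<dots> = 1" unfolding d(2)[symmetric] using \<open>x \<noteq> 0\<close> \<open>y \<noteq> 0\<close> by simp
    finally have "a dvd\<^sub>D 1" using valuation_witness_dvd[OF V dV] by simp
    then show False using aD(3) by contradiction
  qed
  ultimately show ?thesis by (simp add: primeideal_iff)
qed

text \<open>
  Some power of \<open>b\<close> is a common multiple of \<open>a\<close> and \<open>b\<close>.
\<close>

lemma valuation_elements_comparable:
  assumes "valuation_element D a" "valuation_element D b" "b \<in> radical a"
  shows "a dvd\<^sub>D b \<or> b dvd\<^sub>D a"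
proof -
  have D: "a \<in> D" "b \<in> D" using assms valuation_elementD by auto
  obtain n where n: "a dvd\<^sub>D b ^ n" using assms(3) by (auto simp: radical_def)
  have "a dvd\<^sub>D b ^ Suc n" "b dvd\<^sub>D b ^ Suc n"
    using n D dvd_mult2[of a "b ^ n" b] dvdI[OF power_mem, of b b n] by auto
  then show ?thesis using power_divisors_comparable[OF assms(2)] D by blast
qed

end


section \<open>Valuation factorization domains\<close>

locale valuation_factorization_domain =
  fixes D :: "'k::field set"
  assumes VFD: "VFD D"

sublocale valuation_factorization_domain \<subseteq> subring_of_field D
  by (rule subring_of_field.intro, insert VFD, unfold VFD_def domain_with_quotient_field_def) (elim conjE)

context valuation_factorization_domain
begin

lemma quotient_field: "domain_with_quotient_field D"
  using VFD unfolding VFD_def by (rule conjunct1)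

lemma valuation_factorization:
  "x \<in> nonzero_nonunits D \<Longrightarrow> \<exists>as. (\<forall>a\<in>set as. valuation_element D a) \<and> x = prod_list as"
  using VFD unfolding VFD_def by (rule conjunct2[THEN bspec])

lemma VFD_induct [consumes 2, case_names unit mult]:
  assumes "x \<in> D" "x \<noteq> 0"
    and unit: "\<And>u. \<lbrakk>u \<in> D; u dvd\<^sub>D 1\<rbrakk> \<Longrightarrow> P u"
    and mult: "\<And>a x. \<lbrakk>valuation_element D a; x \<in> D; x \<noteq> 0; P x\<rbrakk> \<Longrightarrow> P (a * x)"
  shows "P x"
proof (cases "x dvd\<^sub>D 1")
  case False
  then have "x \<in> nonzero_nonunits D" using assms(1,2) by (simp add: nonzero_nonunits_iff)
  then obtain as where as: "\<forall>a\<in>set as. valuation_element D a" "x = prod_list as"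
    using valuation_factorization by blast
  have "prod_list as \<in> D \<and> prod_list as \<noteq> 0 \<and> P (prod_list as)"
    using as(1)
  proof (induction as)
    case (Cons a as)
    then show ?case using mult[of a "prod_list as"] valuation_elementD[of a] mult_mem by auto
  qed (simp add: unit)
  then show ?thesis using as(2) by simp
qed (use assms in auto)

lemma valuation_factor_in_prime:
  assumes P: "primeideal P (ring_on D)" and x: "x \<in> P" "x \<noteq> 0"
  shows "\<exists>a\<in>P. valuation_element D a \<and> a dvd\<^sub>D x"
proof -
  have "x \<in> D" using P x by (auto simp: primeideal_iff ideal_iff)
  then show ?thesis using x(2,1)
  proof (induction x rule: VFD_induct)
    case (unit u)
    then show ?case using primeideal_dvd[OF P, of u 1] P by (auto simp: primeideal_iff)
  next
    case (mult a x)
    have "a \<in> D" using mult(1) valuation_elementD by blast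
    then have "a \<in> P \<or> x \<in> P" using P mult by (auto simp: primeideal_iff)
    then show ?case
    proof
      assume "x \<in> P"
      then show ?thesis using mult.IH dvd_mult2 \<open>a \<in> D\<close> by blast
    qed (use mult dvdI in blast)
  qed
qed

text \<open>
  Each \<open>s\<close> has a valuation factor \<open>c\<close> in the prime \<open>radical a\<close>.  Since \<open>c\<close> is comparable with \<open>a\<close>, it may
  be replaced by a divisor of \<open>a\<close>, and the divisors of \<open>a\<close> form a chain, from which the smallest
  can be chosen.
\<close>

lemma radical_common_divisor:
  assumes a: "valuation_element D a" and S: "finite S" "S \<subseteq> radical a"
  shows "\<exists>t\<in>radical a. t dvd\<^sub>D a \<and> (\<forall>s\<in>S. t dvd\<^sub>D s)"
  using S
proof (induction S rule: finite_induct)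
  case empty
  then show ?case
    using dvd_imp_mem_radical[OF valuation_elementD(1)[OF a] dvd_refl] by (intro bexI[of _ a]) auto
next
  case (insert s S)
  then obtain t where t: "t \<in> radical a" "t dvd\<^sub>D a" "\<forall>s\<in>S. t dvd\<^sub>D s" by auto
  show ?case
  proof (cases "s = 0")
    case False
    then obtain c where c: "c \<in> radical a" "valuation_element D c" "c dvd\<^sub>D s"
      using valuation_factor_in_prime[OF valuation_radical_prime[OF a]] insert.prems by blast
    have D: "t \<in> D" "c \<in> D" using t c by (auto simp: radical_def)
    show ?thesis
    proof (cases "c dvd\<^sub>D a")
      case True
      then have "t dvd\<^sub>D c \<or> c dvd\<^sub>D t"
        using power_divisors_comparable[OF a, of t 1 c] t(2) D by simp
      then show ?thesis using t c True dvd_trans by blast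
    next
      case False
      then have "a dvd\<^sub>D c" using valuation_elements_comparable[OF a c(2,1)] by blast
      then show ?thesis using t c dvd_trans by blast
    qed
  qed (use t in auto)
qed

lemma radical_prime_t_ideal:
  assumes a: "valuation_element D a" shows "prime_t_ideal D (radical a)"
proof (rule prime_t_idealI[OF valuation_radical_prime[OF a]])
  have "a \<in> radical a" using dvd_imp_mem_radical valuation_elementD[OF a] by simp
  then show "radical a \<noteq> {0}" using valuation_elementD[OF a] by auto
  fix S assume "finite S" "S \<subseteq> radical a"
  then obtain t where "t \<in> radical a" "t dvd\<^sub>D a" "\<forall>s\<in>S. t dvd\<^sub>D s"
    using radical_common_divisor[OF a] by blast
  moreover have "t \<noteq> 0" using \<open>t dvd\<^sub>D a\<close> valuation_elementD[OF a] by (auto simp: divides_in_def)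
  ultimately show "\<exists>t\<in>radical a. t \<noteq> 0 \<and> (\<forall>s\<in>S. t dvd\<^sub>D s)" by blast
qed

text \<open>
  A prime containing \<open>x\<close> contains a valuation factor \<open>a\<close> of \<open>x\<close>, and with it the prime \<open>radical a\<close>,
  which already contains \<open>xD\<close>.
\<close>

lemma minimal_prime_over_eq_radical:
  assumes P: "minimal_prime_over D (scaled_set x D) P" and x: "x \<in> D" "x \<noteq> 0"
  shows "\<exists>a. valuation_element D a \<and> P = radical a"
proof -
  have prime: "primeideal P (ring_on D)" and "x \<in> P"
    using P by (auto simp: minimal_prime_over_def scaled_set_eq)
  then obtain a where a: "a \<in> P" "valuation_element D a" "a dvd\<^sub>D x"
    using valuation_factor_in_prime x by blast
  have "scaled_set x D \<subseteq> radical a"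
    using a(3) x(1) dvd_trans by (auto simp: scaled_set_eq intro!: dvd_imp_mem_radical dest: dvd_mem)
  then have "radical a = P"
    using P radical_subset_primeideal[OF prime a(1)] valuation_radical_prime[OF a(2)]
    by (auto simp: minimal_prime_over_def)
  then show ?thesis using a(2) by blast
qed

lemma radical_minimal_prime_over:
  assumes a: "valuation_element D a"
  shows "minimal_prime_over D (scaled_set a D) (radical a)"
proof -
  have "scaled_set a D \<subseteq> radical a"
    using valuation_elementD[OF a] by (auto simp: scaled_set_eq intro!: dvd_imp_mem_radical dest: dvd_mem)
  moreover have "radical a \<subseteq> Q" if "primeideal Q (ring_on D)" "scaled_set a D \<subseteq> Q" for Q
  proof (rule radical_subset_primeideal[OF that(1)])
    show "a \<in> Q" using that(2) by (auto simp: scaled_set_eq)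
  qed
  ultimately show ?thesis
    using valuation_radical_prime[OF a] by (auto simp: minimal_prime_over_def)
qed

text \<open>
  The powers of some valuation element \<open>a\<close> have a nonzero common multiple.  Their common multiples form
  a prime \<open>Q\<close> inside \<open>radical a\<close> that misses \<open>a\<close>, and \<open>Q\<close> contains a valuation element \<open>b\<close>.
\<close>

lemma smaller_radical_if_not_archimedean:
  assumes "\<not> archimedean D"
  shows "\<exists>a b. valuation_element D a \<and> valuation_element D b \<and> radical b \<subset> radical a"
proof -
  obtain x y where x: "x \<in> D" "x \<noteq> 0" "\<not> x dvd\<^sub>D 1" and y: "y \<noteq> 0" "\<And>n. x ^ n dvd\<^sub>D y"
    using assms by (auto simp: archimedean_iff nonzero_nonunits_iff)
  obtain a where a: "valuation_element D a" "a dvd\<^sub>D x"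
    using x by (induction x rule: VFD_induct) (auto intro: dvdI)
  have aD: "a \<in> D" "a \<noteq> 0" "\<not> a dvd\<^sub>D 1" using valuation_elementD[OF a(1)] .
  define Q where "Q = {x. \<forall>n. a ^ n dvd\<^sub>D x}"
  have prime: "primeideal Q (ring_on D)" unfolding Q_def by (rule valuation_powers_Inter_prime[OF a(1)])
  have "y \<in> Q" using y(2) dvd_power_mono[OF a(2)] dvd_trans unfolding Q_def by blast
  then obtain b where b: "b \<in> Q" "valuation_element D b"
    using valuation_factor_in_prime[OF prime] y(1) by blast
  have "Q \<subseteq> radical a"
  proof
    fix z assume z: "z \<in> Q"
    then have "z \<in> D" using prime by (auto simp: primeideal_iff ideal_iff)
    moreover have "a ^ 1 dvd\<^sub>D z" using z unfolding Q_def by blast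
    ultimately show "z \<in> radical a" by (simp add: dvd_imp_mem_radical)
  qed
  moreover have "a \<notin> Q"
  proof
    assume "a \<in> Q"
    then have "a ^ 2 dvd\<^sub>D a" unfolding Q_def by blast
    then have "a * a dvd\<^sub>D a * 1" by (simp add: power2_eq_square)
    then have "a dvd\<^sub>D 1" by (simp only: dvd_mult_cancel[OF aD(2)])
    then show False using aD(3) by contradiction
  qed
  moreover have "a \<in> radical a" using aD by (simp add: dvd_imp_mem_radical)
  moreover have "radical b \<subseteq> Q" using radical_subset_primeideal[OF prime b(1)] .
  ultimately show ?thesis using a(1) b(2) by blast
qed

end


section \<open>Archimedean valuation factorization domains\<close>

locale archimedean_VFD = valuation_factorization_domain +
  assumes arch: "archimedean D"
begin

text \<open>
  Some \<open>b\<^sup>n\<close> does not divide \<open>a\<close>.  But \<open>a\<close> and \<open>b\<^sup>n\<close> both divide \<open>a\<^sup>n\<close>, so they are comparable.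
\<close>

lemma divisor_mem_radical:
  assumes a: "valuation_element D a" and b: "b \<in> D" "\<not> b dvd\<^sub>D 1" "b dvd\<^sub>D a"
  shows "b \<in> radical a"
proof -
  have a0: "a \<in> D" "a \<noteq> 0" using valuation_elementD[OF a] by auto
  have "b \<in> nonzero_nonunits D" using b a0 by (auto simp: nonzero_nonunits_iff divides_in_def)
  then obtain n where n: "\<not> b ^ n dvd\<^sub>D a" using arch a0 by (auto simp: archimedean_iff)
  then have "n \<noteq> 0" using a0 by (cases n) auto
  have "b ^ n dvd\<^sub>D a ^ n" using dvd_power_mono[OF b(3)] .
  moreover have "a dvd\<^sub>D a ^ n" using power_dvd_power[OF a0(1), of 1 n] \<open>n \<noteq> 0\<close> by simp
  ultimately have "a dvd\<^sub>D b ^ n"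
    using power_divisors_comparable[OF a] n a0(1) power_mem[OF b(1)] by blast
  then show ?thesis using radicalI[OF b(1)] by blast
qed

text \<open>
  Suppose that \<open>a\<close> divides \<open>y * x\<close>, and consider a valuation factor \<open>b\<close> of \<open>x\<close>.  If \<open>b\<close> is outside the
  prime \<open>radical a\<close>, it is moved over to \<open>y\<close>.  Otherwise it is comparable with \<open>a\<close>.  If \<open>b\<close> is the
  smaller one, it cancels and leaves a divisor \<open>c\<close> of \<open>a\<close>; by the archimedean property
  \<open>radical c \<subseteq> radical a\<close> unless \<open>c\<close> is a unit, so \<open>y\<close> is still outside and induction applies.  The
  induction is over \<open>x\<close>, with \<open>a\<close> and \<open>y\<close> varying.
\<close>

lemma valuation_v_coprime:
  assumes "valuation_element D a" "y \<in> D" "y \<notin> radical a"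
  shows "v_coprime a y"
proof -
  have "a dvd\<^sub>D x"
    if "x \<in> D" "x \<noteq> 0" "valuation_element D a" "y \<in> D" "y \<notin> radical a" "a dvd\<^sub>D y * x" for x a y
    using that
  proof (induction x arbitrary: a y rule: VFD_induct)
    case (unit u)
    then obtain w where w: "w \<in> D" "1 = u * w" by (auto elim: dvdE)
    have "y * u * w = y" using w(2) by (metis mult.assoc mult_1_right)
    then have "a dvd\<^sub>D y" using dvd_mult[OF unit.prems(4) w(1)] by (simp only:)
    then show ?case using unit.prems dvd_imp_mem_radical by blast
  next
    case (mult b x)
    have aD: "a \<in> D" "a \<noteq> 0" and bD: "b \<in> D" "b \<noteq> 0" using mult valuation_elementD by auto
    show ?case
    proof (cases "b \<in> radical a")
      case True
      then consider "a dvd\<^sub>D b" | "b dvd\<^sub>D a"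
        using valuation_elements_comparable mult.prems(1) mult.hyps(1) by blast
      then show ?thesis
      proof cases
        case 1
        then show ?thesis using dvd_mult mult by blast
      next
        case 2
        then obtain c where c: "c \<in> D" "a = b * c" by (rule dvdE)
        have "b * c dvd\<^sub>D b * (y * x)" using mult.prems(4) c(2) by (simp add: ac_simps)
        then have cyx: "c dvd\<^sub>D y * x" using dvd_mult_cancel[OF bD(2)] by simp
        have "c dvd\<^sub>D x"
        proof (cases "c dvd\<^sub>D 1")
          case True
          then show ?thesis using dvd_trans mult by (metis one_dvd_iff)
        next
          case False
          have "c dvd\<^sub>D a" using c bD dvdI' by simp
          then have "valuation_element D c" "c \<in> radical a"
            using valuation_element_divisor divisor_mem_radical mult.prems(1) c(1) False by blast+
          then show ?thesis using mult.IH mult.prems(2,3) radical_trans cyx by blast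
        qed
        then show ?thesis using c(2) dvd_mult_cancel[OF bD(2)] by simp
      qed
    next
      case False
      then have "y * b \<notin> radical a"
        using valuation_radical_prime[OF mult.prems(1)] mult.prems bD by (auto simp: primeideal_iff)
      then have "a dvd\<^sub>D x"
        using mult.IH[of a "y * b"] mult.prems bD mult_mem by (simp add: mult.assoc)
      then show ?thesis using dvd_mult2 bD by blast
    qed
  qed
  then show ?thesis unfolding v_coprime_def using assms dvd_zero by metis
qed

lemma valuation_element_primary:
  assumes a: "valuation_element D a" shows "primary_element D a"
  unfolding primary_element_iff
proof (intro conjI ballI impI)
  show "a \<in> nonzero_nonunits D" using a by (simp add: valuation_element_def)
  fix x y assume xy: "x \<in> D" "y \<in> D" "a dvd\<^sub>D x * y"
  show "a dvd\<^sub>D x \<or> (\<exists>n\<ge>1. a dvd\<^sub>D y ^ n)"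
  proof (cases "y \<in> radical a")
    case True
    then obtain n where "a dvd\<^sub>D y ^ n" by (auto simp: radical_def)
    then have "a dvd\<^sub>D y ^ Suc n" using dvd_mult2 xy(2) by simp
    then show ?thesis by (intro disjI2 exI[of _ "Suc n"]) simp
  next
    case False
    then have "v_coprime a y" using valuation_v_coprime[OF a xy(2)] by blast
    then show ?thesis using v_coprimeD xy(1,3) by (simp add: mult.commute)
  qed
qed

text \<open>
  A valuation element \<open>b\<close> of \<open>Q\<close> lies in \<open>radical a\<close>.  Valuation elements being primary, \<open>a\<close> lies in
  \<open>radical b\<close>, hence in \<open>Q\<close>.
\<close>

lemma nonzero_prime_in_radical:
  assumes a: "valuation_element D a" and Q: "primeideal Q (ring_on D)" "Q \<noteq> {0}" "Q \<subseteq> radical a"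
  shows "Q = radical a"
proof -
  have "0 \<in> Q" using Q(1) by (auto simp: primeideal_iff ideal_iff)
  then obtain x where "x \<in> Q" "x \<noteq> 0" using Q(2) by blast
  then obtain b where b: "b \<in> Q" "valuation_element D b"
    using valuation_factor_in_prime[OF Q(1)] by blast
  have "a \<in> radical b"
    using primary_radical_sym[OF valuation_element_primary[OF a] valuation_element_primary[OF b(2)]] b(1) Q(3)
    by blast
  then have "radical a \<subseteq> Q"
    using radical_trans radical_subset_primeideal[OF Q(1) b(1)] by blast
  then show ?thesis using Q(3) by blast
qed

text \<open>
  An element of \<open>Q\<close> outside \<open>radical a\<close> would be coprime to \<open>a \<in> Q\<close>.
\<close>

lemma prime_t_ideal_eq_radical:
  assumes Q: "prime_t_ideal D Q" shows "\<exists>a. valuation_element D a \<and> Q = radical a"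
proof -
  have prime: "primeideal Q (ring_on D)" and "Q \<noteq> {0}" using Q by (auto simp: prime_t_ideal_def)
  moreover have "0 \<in> Q" "Q \<subseteq> D" using prime by (auto simp: primeideal_iff ideal_iff)
  ultimately obtain x where "x \<in> Q" "x \<noteq> 0" by blast
  then obtain a where a: "a \<in> Q" "valuation_element D a"
    using valuation_factor_in_prime[OF prime] by blast
  have "Q \<subseteq> radical a"
    using prime_t_ideal_not_v_coprime[OF Q a(1) _ valuation_elementD(2)[OF a(2)]]
      valuation_v_coprime[OF a(2)] \<open>Q \<subseteq> D\<close> by blast
  then show ?thesis using radical_subset_primeideal[OF prime a(1)] a(2) by blast
qed

lemma coprime_split_valuation_valuation:
  assumes a: "valuation_element D a" and b: "valuation_element D b"
  shows "coprime_split a b"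
proof (cases "b \<in> radical a")
  case True
  then have "a dvd\<^sub>D b \<or> b dvd\<^sub>D a" using valuation_elements_comparable[OF a b] by blast
  then show ?thesis
    using coprime_split_dvd coprime_split_sym valuation_elementD[OF a] valuation_elementD[OF b] by blast
next
  case False
  then show ?thesis
    using valuation_v_coprime[OF a] valuation_elementD[OF a] valuation_elementD[OF b]
    by (intro coprime_splitI[of 1 a b]) auto
qed

text \<open>
  After the common part of \<open>a\<close> and \<open>b\<close> has been split off, \<open>x\<close> still has to be split against what
  remains of \<open>b\<close>; this is why the last hypothesis ranges over the divisors of \<open>b\<close>.
\<close>

lemma coprime_split_factorwise:
  assumes ab: "coprime_split a b" and D: "a \<noteq> 0" "b \<noteq> 0"
    and IH: "\<And>b'. \<lbrakk>b' \<in> D; b' dvd\<^sub>D b; b' \<noteq> 0\<rbrakk> \<Longrightarrow> coprime_split x b'"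
  shows "coprime_split (a * x) b"
proof -
  obtain g a' b' where g: "g \<in> D" "a' \<in> D" "b' \<in> D" "a = g * a'" "b = g * b'" "v_coprime a' b'"
    using ab by (rule coprime_splitE)
  then have "b' dvd\<^sub>D b" "b' \<noteq> 0" "a' \<noteq> 0" using D by (auto intro: dvdI')
  then show ?thesis
    using coprime_split_mult[OF g(1-3) _ g(6) IH] g by simp
qed

lemma coprime_split_unit: "u \<in> D \<Longrightarrow> u dvd\<^sub>D 1 \<Longrightarrow> x \<in> D \<Longrightarrow> coprime_split u x"
  using coprime_split_dvd[of u x] dvd_trans[of u 1 x] by simp

lemma coprime_split_valuation:
  assumes "x \<in> D" "x \<noteq> 0" "valuation_element D b"
  shows "coprime_split x b"
proof -
  \<comment> \<open>Units are included to make the induction hypothesis apply to every divisor of \<open>b\<close>.\<close>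
  have "coprime_split x b" if "b \<in> D" "b dvd\<^sub>D 1 \<or> valuation_element D b" for b
    using assms(1,2) that
  proof (induction x arbitrary: b rule: VFD_induct)
    case (unit u)
    then show ?case using coprime_split_unit by blast
  next
    case (mult a x)
    have aD: "a \<in> D" "a \<noteq> 0" using mult valuation_elementD by auto
    from mult.prems(2) show ?case
    proof
      assume b: "b dvd\<^sub>D 1"
      then have "b \<noteq> 0" by (auto simp: divides_in_def)
      then show ?thesis
        using coprime_split_sym coprime_split_unit mult aD mult_mem b by blast
    next
      assume b: "valuation_element D b"
      show ?thesis
      proof (rule coprime_split_factorwise)
        show "coprime_split a b" using coprime_split_valuation_valuation mult.hyps(1) b .
        show "coprime_split x b'" if "b' \<in> D" "b' dvd\<^sub>D b" for b'
          using mult.IH that valuation_element_divisor[OF b] by blast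
      qed (use aD valuation_elementD[OF b] in auto)
    qed
  qed
  then show ?thesis using assms(3) valuation_elementD by blast
qed

lemma coprime_split:
  assumes "x \<in> D" "y \<in> D" "x \<noteq> 0" "y \<noteq> 0"
  shows "coprime_split x y"
  using assms(1,3,2,4)
proof (induction x arbitrary: y rule: VFD_induct)
  case (unit u)
  then show ?case using coprime_split_unit by blast
next
  case (mult a x)
  have "coprime_split a y"
    using coprime_split_sym coprime_split_valuation mult.prems mult.hyps(1) by blast
  then show ?case
    using coprime_split_factorwise mult valuation_elementD by blast
qed

lemma weakly_factorial: "weakly_factorial D"
  unfolding weakly_factorial_def
proof (intro conjI ballI)
  fix x assume "x \<in> nonzero_nonunits D"
  then obtain as where "\<forall>a\<in>set as. valuation_element D a" "x = prod_list as"
    using valuation_factorization by blast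
  then show "\<exists>ps. (\<forall>p\<in>set ps. primary_element D p) \<and> x = prod_list ps"
    using valuation_element_primary by blast
qed (rule quotient_field)

lemma GCD: "GCD_domain D"
  by (rule GCD_domain_if_gcd[OF quotient_field], rule gcd_if_coprime_split[OF coprime_split])

lemma completely_integrally_closed: "completely_integrally_closed D"
  by (rule completely_integrally_closed_if_coprime_split[OF quotient_field arch coprime_split])

lemma t_dim:
  assumes "\<not> field (ring_on D)" shows "t_dim D = 1"
proof -
  obtain x where "x \<in> D" "x \<noteq> 0" "\<not> x dvd\<^sub>D 1"
    using exists_nonzero_nonunit[OF assms] by (auto simp: nonzero_nonunits_iff)
  then obtain a where a: "valuation_element D a"
    by (induction x rule: VFD_induct) auto
  show ?thesis
  proof (rule t_dim_eq_1I[OF radical_prime_t_ideal[OF a]])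
    fix P Q assume "prime_t_ideal D P" "prime_t_ideal D Q"
    then show "\<not> P \<subset> Q"
      using prime_t_ideal_eq_radical[of Q] nonzero_prime_in_radical[of _ P]
      by (auto simp: prime_t_ideal_def)
  qed
qed

lemma principal_ideal_theorem: "principal_ideal_theorem D"
  unfolding principal_ideal_theorem_def
proof (intro ballI impI allI)
  fix x P assume "x \<in> D" "x \<noteq> 0" "minimal_prime_over D (scaled_set x D) P"
  then obtain a where a: "valuation_element D a" "P = radical a"
    using minimal_prime_over_eq_radical by blast
  have "prime_t_ideal D P" using radical_prime_t_ideal a by simp
  then show "height D P = 1"
    using nonzero_prime_in_radical[OF a(1)] a(2) by (intro height_eq_1I) (auto simp: prime_t_ideal_def)
qed

end


section \<open>Equivalence of the five conditions\<close>

theorem proposition4p6: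
  fixes D :: "'k::field set"
  assumes "VFD D" and "\<not> field (ring_on D)"
  shows "(weakly_factorial D \<and> GCD_domain D \<longleftrightarrow> t_dim D = 1) \<and>
         (t_dim D = 1 \<longleftrightarrow> completely_integrally_closed D) \<and>
         (completely_integrally_closed D \<longleftrightarrow> archimedean D) \<and>
         (archimedean D \<longleftrightarrow> principal_ideal_theorem D)"
proof -
  interpret valuation_factorization_domain D by unfold_locales (rule assms(1))
  have arch: "archimedean_VFD D" if "archimedean D"
    using that by unfold_locales
  have "archimedean D" if "t_dim D = 1"
    using smaller_radical_if_not_archimedean t_dim_eq_1D[OF that] radical_prime_t_ideal by blast
  moreover have "archimedean D" if PIT: "principal_ideal_theorem D"
  proof (rule ccontr)
    assume "\<not> archimedean D"
    then obtain a b where ab: "valuation_element D a" "valuation_element D b" "radical b \<subset> radical a"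
      using smaller_radical_if_not_archimedean by blast
    have "height D (radical a) = 1"
      using PIT radical_minimal_prime_over[OF ab(1)] valuation_elementD[OF ab(1)]
      by (auto simp: principal_ideal_theorem_def)
    then show False
      using height_eq_1D radical_prime_t_ideal[OF ab(2)] ab(3) by (auto simp: prime_t_ideal_def)
  qed
  ultimately show ?thesis
    using archimedean_if_weakly_factorial archimedean_if_completely_integrally_closed
      archimedean_VFD.weakly_factorial[OF arch] archimedean_VFD.GCD[OF arch]
      archimedean_VFD.completely_integrally_closed[OF arch] archimedean_VFD.t_dim[OF arch assms(2)]
      archimedean_VFD.principal_ideal_theorem[OF arch]
    by blast
qed

end
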